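(* Let $X$ be a (nonempty) finite metric space. Its Rips magnitude function $t\mapsto|tX|_{\mathrm{Rips}}$, $t\in(0,\infty)$, has the following properties. (1) $$|tX|_{\mathrm{Rips}}=\sum_{A\subseteq X,\,A\neq\emptyset}(-1)^{\#A-1}e^{-\mathrm{diam}(A)t}.$$ (2) If $H_\ast(\mathcal{R}(X))$ has barcode with bars $[a_{k,0},b_{k,0}),\ldots,[a_{k,m_k},b_{k,m_k})$ in degree $k$, then $$|tX|_{\mathrm{Rips}}=\sum_{k=0}^{\#X-1}\sum_{j=0}^{m_k}(-1)^k\bigl(e^{-a_{k,j}t}-e^{-b_{k,j}t}\bigr).$$ (3) If $0=d_0<d_1<\cdots<d_n$ is the set of all pairwise distances between elements of $X$ arranged in a sequence and $d_{n+1}=\infty$, then $$|tX|_{\mathrm{Rips}}=\sum_{j=0}^n\chi(\mathcal{R}_{d_j}(X))\bigl(e^{-d_jt}-e^{-d_{j+1}t}\bigr).$$ (4) $\lim_{t\to0}|tX|_{\mathrm{Rips}}=1$ and $\lim_{t\to\infty}|tX|_{\mathrm{Rips}}=\#X$.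
   Context: $\#A$ is the cardinality of a finite set $A$, $\mathrm{diam}$ is diameter, $\chi$ is the Euler characteristic. Fix a field $\Bbbk$. The Vietoris–Rips complex $\mathcal{R}(X)$ of a finite metric space $X$ is the $(\mathbb{R},\le)$-filtered simplicial complex with vertex set $X$ whose $r$-th stage $\mathcal{R}_r(X)$ has as simplices the nonempty $\sigma\subseteq X$ with $\mathrm{diam}\,\sigma\le r$. Its simplicial chains $C_\ast(\mathcal{R}(X))$ (with $\Bbbk$ coefficients) form a chain complex of persistence modules, and its homology $H_\ast(\mathcal{R}(X))$, $r\mapsto H_\ast(\mathcal{R}_r(X))$, is a graded persistence module. A persistence module is a functor $(\mathbb{R},\le)\to\mathbf{Vect}_\Bbbk$. The interval module $\Bbbk[a,b)$ ($-\infty<a<b\le\infty$) is $\Bbbk$ on $[a,b)$ and $0$ elsewhere, with identity structure maps between points of $[a,b)$. A finitely presented persistence module is one isomorphic to a finite direct sum $\bigoplus_i\Bbbk[a_i,b_i)$; the intervals $[a_i,b_i)$ are its bars (a degree may have no bars, in which case the corresponding inner sum is empty). Its magnitude function is $|tM|=\sum_i(e^{-a_it}-e^{-b_it})$, $t\in(0,\infty)$, with $e^{-\infty}=0$; for a finitely presented graded persistence module $|tM_\ast|=\sum_i(-1)^i|tM_i|$. The Rips magnitude function of $X$ is $|tX|_{\mathrm{Rips}}=|tC_\ast(\mathcal{R}(X))|=|tH_\ast(\mathcal{R}(X))|$ (these two are equal); the Rips magnitude $|X|_{\mathrm{Rips}}$ is its value at $t=1$. *)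

theory Defs
  imports "HOL-Analysis.Analysis" "HOL-Algebra.Module" "HOL-Algebra.AbelCoset"
begin

section \<open>Vector spaces with explicit carriers\<close>

text \<open>A vector space over a field \<open>K\<close> is a HOL-Algebra module over \<open>K\<close>.  The record type of modules
  extends that of rings; its multiplicative fields play no role and are left undefined.\<close>

definition vec_space :: "'v set \<Rightarrow> 'v \<Rightarrow> ('v \<Rightarrow> 'v \<Rightarrow> 'v) \<Rightarrow> ('k \<Rightarrow> 'v \<Rightarrow> 'v) \<Rightarrow> ('k, 'v) module" where
  "vec_space C z p s =
     \<lparr>carrier = C, monoid.mult = undefined, one = undefined, zero = z, add = p, smult = s\<rparr>"

definition linear_maps ::
  "('k, 'c) ring_scheme \<Rightarrow> ('k, 'v) module \<Rightarrow> ('k, 'w) module \<Rightarrow> ('v \<Rightarrow> 'w) set" where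
  "linear_maps K V W = {f \<in> carrier V \<rightarrow> carrier W.
     (\<forall>x\<in>carrier V. \<forall>y\<in>carrier V. f (x \<oplus>\<^bsub>V\<^esub> y) = f x \<oplus>\<^bsub>W\<^esub> f y) \<and>
     (\<forall>c\<in>carrier K. \<forall>x\<in>carrier V. f (c \<odot>\<^bsub>V\<^esub> x) = c \<odot>\<^bsub>W\<^esub> f x)}"

text \<open>The quotient of a subspace \<open>Z\<close> of \<open>V\<close> by a subspace \<open>B\<close> of \<open>Z\<close>, with cosets \<open>B + z\<close> as elements.
  Adding \<open>B\<close> in the scalar multiplication makes \<open>\<zero> \<odot> C\<close> the coset \<open>B\<close> rather than the singleton of zero.\<close>

definition subquotient :: "('k, 'v) module \<Rightarrow> 'v set \<Rightarrow> 'v set \<Rightarrow> ('k, 'v set) module" where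
  "subquotient V Z B = vec_space ((\<lambda>z. B +>\<^bsub>V\<^esub> z) ` Z) B (\<lambda>C D. C <+>\<^bsub>V\<^esub> D)
     (\<lambda>a C. B <+>\<^bsub>V\<^esub> ((\<lambda>c. a \<odot>\<^bsub>V\<^esub> c) ` C))"


section \<open>Persistence modules\<close>

text \<open>\<open>pmap M r s\<close> is the structure map from stage \<open>r\<close> to stage \<open>s\<close>; only its values for \<open>r \<le> s\<close> on
  the carrier of stage \<open>r\<close> are meaningful.\<close>

record ('k, 'v) pmodule =
  stage :: "real \<Rightarrow> ('k, 'v) module"
  pmap :: "real \<Rightarrow> real \<Rightarrow> 'v \<Rightarrow> 'v"

definition persistence_module :: "('k, 'c) ring_scheme \<Rightarrow> ('k, 'v) pmodule \<Rightarrow> bool" where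
  "persistence_module K M \<longleftrightarrow>
     (\<forall>r. Module.module K (stage M r)) \<and>
     (\<forall>r s. r \<le> s \<longrightarrow> pmap M r s \<in> linear_maps K (stage M r) (stage M s)) \<and>
     (\<forall>r. \<forall>x\<in>carrier (stage M r). pmap M r r x = x) \<and>
     (\<forall>r s u. r \<le> s \<longrightarrow> s \<le> u \<longrightarrow>
        (\<forall>x\<in>carrier (stage M r). pmap M s u (pmap M r s x) = pmap M r u x))"

definition pm_iso :: "('k, 'c) ring_scheme \<Rightarrow> ('k, 'v) pmodule \<Rightarrow> ('k, 'w) pmodule \<Rightarrow> bool" where
  "pm_iso K M N \<longleftrightarrow> persistence_module K M \<and> persistence_module K N \<and>
     (\<exists>f. (\<forall>r. f r \<in> linear_maps K (stage M r) (stage N r) \<and>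
               bij_betw (f r) (carrier (stage M r)) (carrier (stage N r))) \<and>
          (\<forall>r s. r \<le> s \<longrightarrow>
             (\<forall>x\<in>carrier (stage M r). f s (pmap M r s x) = pmap N r s (f r x))))"

definition interval_module :: "('k, 'c) ring_scheme \<Rightarrow> real \<Rightarrow> ereal \<Rightarrow> ('k, 'k) pmodule" where
  "interval_module K a b =
     (let I = {r. a \<le> r \<and> ereal r < b} in
      \<lparr>stage = (\<lambda>r. vec_space (if r \<in> I then carrier K else {\<zero>\<^bsub>K\<^esub>}) \<zero>\<^bsub>K\<^esub> (add K) (monoid.mult K)),
       pmap = (\<lambda>r s x. if r \<in> I \<and> s \<in> I then x else \<zero>\<^bsub>K\<^esub>)\<rparr>)"

definition pm_direct_sum :: "nat \<Rightarrow> (nat \<Rightarrow> ('k, 'v) pmodule) \<Rightarrow> ('k, nat \<Rightarrow> 'v) pmodule" where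
  "pm_direct_sum n M =
     \<lparr>stage = (\<lambda>r. vec_space
        (\<Pi>\<^sub>E i\<in>{..<n}. carrier (stage (M i) r))
        (\<lambda>i\<in>{..<n}. \<zero>\<^bsub>stage (M i) r\<^esub>)
        (\<lambda>f g. \<lambda>i\<in>{..<n}. f i \<oplus>\<^bsub>stage (M i) r\<^esub> g i)
        (\<lambda>c f. \<lambda>i\<in>{..<n}. c \<odot>\<^bsub>stage (M i) r\<^esub> f i)),
      pmap = (\<lambda>r s f. \<lambda>i\<in>{..<n}. pmap (M i) r s (f i))\<rparr>"

text \<open>The bars are \<open>[a i, b i)\<close> for \<open>i < n\<close>; there are none if \<open>n = 0\<close>.\<close>

definition has_barcode ::
  "('k, 'c) ring_scheme \<Rightarrow> ('k, 'v) pmodule \<Rightarrow> nat \<Rightarrow> (nat \<Rightarrow> real) \<Rightarrow> (nat \<Rightarrow> ereal) \<Rightarrow> bool" where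
  "has_barcode K M n a b \<longleftrightarrow> (\<forall>i<n. ereal (a i) < b i) \<and>
     pm_iso K M (pm_direct_sum n (\<lambda>i. interval_module K (a i) (b i)))"

definition graded_has_barcode ::
  "('k, 'c) ring_scheme \<Rightarrow> (nat \<Rightarrow> ('k, 'v) pmodule) \<Rightarrow>
     (nat \<Rightarrow> nat) \<Rightarrow> (nat \<Rightarrow> nat \<Rightarrow> real) \<Rightarrow> (nat \<Rightarrow> nat \<Rightarrow> ereal) \<Rightarrow> bool" where
  "graded_has_barcode K M n a b \<longleftrightarrow> (\<forall>k. has_barcode K (M k) (n k) (a k) (b k))"


section \<open>Magnitude\<close>

text \<open>\<open>exp_neg b t\<close> is $e^{-bt}$, with the convention $e^{-\infty} = 0$; it is not used at \<open>b = -\<infinity>\<close>.\<close>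

definition exp_neg :: "ereal \<Rightarrow> real \<Rightarrow> real" where
  "exp_neg b t = (if b = \<infinity> then 0 else exp (- real_of_ereal b * t))"

text \<open>Meaningful for finitely presented \<open>M\<close>; the value does not depend on the decomposition.\<close>

definition magnitude :: "('k, 'c) ring_scheme \<Rightarrow> ('k, 'v) pmodule \<Rightarrow> real \<Rightarrow> real" where
  "magnitude K M t = (THE s. \<exists>n a b. has_barcode K M n a b \<and>
     s = (\<Sum>i<n. exp_neg (ereal (a i)) t - exp_neg (b i) t))"

text \<open>The sum ranges over the degrees of the nonzero modules, which are finitely many if the graded
  module is finitely presented.\<close>

definition graded_magnitude :: "('k, 'c) ring_scheme \<Rightarrow> (nat \<Rightarrow> ('k, 'v) pmodule) \<Rightarrow> real \<Rightarrow> real" where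
  "graded_magnitude K M t =
     (\<Sum>k | \<exists>r. carrier (stage (M k) r) \<noteq> {\<zero>\<^bsub>stage (M k) r\<^esub>}. (- 1) ^ k * magnitude K (M k) t)"


section \<open>Finite simplicial complexes\<close>

text \<open>A simplicial complex is the set of its nonempty simplices.  All complexes below are finite.\<close>

definition simplices :: "'a set set \<Rightarrow> nat \<Rightarrow> 'a set set" where
  "simplices S k = {\<sigma> \<in> S. card \<sigma> = k + 1}"

definition euler_characteristic :: "'a set set \<Rightarrow> int" where
  "euler_characteristic S = (\<Sum>k | simplices S k \<noteq> {}. (- 1) ^ k * int (card (simplices S k)))"

text \<open>A chain is given by its coefficients, extended by zero to sets that are not \<open>k\<close>-simplices of
  \<open>S\<close>.  Thus the chains of a subcomplex are chains of \<open>S\<close>.\<close>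

definition chain_space :: "('k, 'c) ring_scheme \<Rightarrow> 'a set set \<Rightarrow> nat \<Rightarrow> ('k, 'a set \<Rightarrow> 'k) module" where
  "chain_space K S k = vec_space
     {c. (\<forall>\<sigma>\<in>simplices S k. c \<sigma> \<in> carrier K) \<and> (\<forall>\<sigma>. \<sigma> \<notin> simplices S k \<longrightarrow> c \<sigma> = \<zero>\<^bsub>K\<^esub>)}
     (\<lambda>\<sigma>. \<zero>\<^bsub>K\<^esub>) (\<lambda>c d \<sigma>. c \<sigma> \<oplus>\<^bsub>K\<^esub> d \<sigma>) (\<lambda>a c \<sigma>. a \<otimes>\<^bsub>K\<^esub> c \<sigma>)"

text \<open>Orientations come from a linear order \<open>ord\<close> of the vertices: if \<open>\<sigma>\<close> has vertices
  $v_0 < \dots < v_k$ and \<open>\<tau>\<close> omits $v_i$, the incidence number is $(-1)^i$, since \<open>i\<close> is the number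
  of vertices of \<open>\<sigma>\<close> preceding the omitted one.\<close>

definition incidence :: "('k, 'c) ring_scheme \<Rightarrow> 'a rel \<Rightarrow> 'a set \<Rightarrow> 'a set \<Rightarrow> 'k" where
  "incidence K ord \<sigma> \<tau> =
     (\<ominus>\<^bsub>K\<^esub> \<one>\<^bsub>K\<^esub>) [^]\<^bsub>K\<^esub> card {y \<in> \<sigma>. \<exists>x\<in>\<sigma> - \<tau>. y \<noteq> x \<and> (y, x) \<in> ord}"

text \<open>The boundary of a \<open>k\<close>-chain.  For \<open>k = 0\<close> it is zero, as the empty set is not a simplex.\<close>

definition boundary ::
  "('k, 'c) ring_scheme \<Rightarrow> 'a rel \<Rightarrow> 'a set set \<Rightarrow> nat \<Rightarrow> ('a set \<Rightarrow> 'k) \<Rightarrow> 'a set \<Rightarrow> 'k" where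
  "boundary K ord S k c \<tau> =
     (if \<tau> \<in> S
      then finsum K (\<lambda>\<sigma>. incidence K ord \<sigma> \<tau> \<otimes>\<^bsub>K\<^esub> c \<sigma>)
             {\<sigma> \<in> simplices S k. \<tau> \<subseteq> \<sigma> \<and> card \<sigma> = Suc (card \<tau>)}
      else \<zero>\<^bsub>K\<^esub>)"

definition cycles :: "('k, 'c) ring_scheme \<Rightarrow> 'a rel \<Rightarrow> 'a set set \<Rightarrow> nat \<Rightarrow> ('a set \<Rightarrow> 'k) set" where
  "cycles K ord S k = {c \<in> carrier (chain_space K S k). boundary K ord S k c = (\<lambda>\<tau>. \<zero>\<^bsub>K\<^esub>)}"

definition boundaries :: "('k, 'c) ring_scheme \<Rightarrow> 'a rel \<Rightarrow> 'a set set \<Rightarrow> nat \<Rightarrow> ('a set \<Rightarrow> 'k) set" where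
  "boundaries K ord S k = boundary K ord S (Suc k) ` carrier (chain_space K S (Suc k))"

definition homology_space ::
  "('k, 'c) ring_scheme \<Rightarrow> 'a rel \<Rightarrow> 'a set set \<Rightarrow> nat \<Rightarrow> ('k, ('a set \<Rightarrow> 'k) set) module" where
  "homology_space K ord S k =
     subquotient (chain_space K S k) (cycles K ord S k) (boundaries K ord S k)"


section \<open>Filtered complexes and the Vietoris--Rips complex\<close>

definition filtered_chains ::
  "('k, 'c) ring_scheme \<Rightarrow> (real \<Rightarrow> 'a set set) \<Rightarrow> nat \<Rightarrow> ('k, 'a set \<Rightarrow> 'k) pmodule" where
  "filtered_chains K F k = \<lparr>stage = (\<lambda>r. chain_space K (F r) k), pmap = (\<lambda>r s c. c)\<rparr>"

text \<open>The structure maps are induced by inclusion of cycles: a class \<open>B\<^sub>r + z\<close> is sent to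
  \<open>B\<^sub>s + (B\<^sub>r + z) = B\<^sub>s + z\<close>.\<close>

definition filtered_homology ::
  "('k, 'c) ring_scheme \<Rightarrow> 'a rel \<Rightarrow> (real \<Rightarrow> 'a set set) \<Rightarrow> nat \<Rightarrow>
     ('k, ('a set \<Rightarrow> 'k) set) pmodule" where
  "filtered_homology K ord F k =
     \<lparr>stage = (\<lambda>r. homology_space K ord (F r) k),
      pmap = (\<lambda>r s C. boundaries K ord (F s) k <+>\<^bsub>chain_space K (F s) k\<^esub> C)\<rparr>"

definition rips :: "'a::metric_space set \<Rightarrow> real \<Rightarrow> 'a set set" where
  "rips X r = {\<sigma>. \<sigma> \<noteq> {} \<and> \<sigma> \<subseteq> X \<and> diameter \<sigma> \<le> r}"

text \<open>The magnitude of the Rips homology is the same function; chains have the advantage that no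
  order of the vertices is involved.\<close>

definition rips_magnitude :: "('k, 'c) ring_scheme \<Rightarrow> 'a::metric_space set \<Rightarrow> real \<Rightarrow> real" where
  "rips_magnitude K X t = graded_magnitude K (filtered_chains K (rips X)) t"

end

theory Submission
  imports Defs "Jordan_Normal_Form.Missing_VectorSpace"
begin

text \<open>A bar $[a,b)$ contributes $e^{-at}-e^{-bt} = \int_{\mathbf R} t e^{-rt}\, 1_{[a,b)}(r)\,dr$ to the
  magnitude, so a signed sum of such contributions depends only on the step function
  $\sum_i w_i 1_{[a_i,b_i)}$.  For a barcode of a persistence module this step function is the
  pointwise dimension, which makes the magnitude well defined.  The bars $[\mathrm{diam}\,A,\infty)$ of
  the Rips chains and the bars of the Rips homology, weighted by $(-1)^k$ in degree $k$, both have the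
  step function $r\mapsto\chi(\mathcal R_r(X))$, the latter because a bounded complex and its homology
  have the same alternating sum of dimensions; this gives (1) and (2).
  Part (3) is a telescoping sum applied to each $A$ in (1), and (4) follows from (1) termwise.\<close>

text \<open>\<open>magnitude\<close> is a definite description over all barcodes, so what has to be
  shown is uniqueness of the value. For fixed t > 0 this value is a linear functional of the
  dimension function: it is integrated against t e^(-rt), the r-derivative of -e^(-rt), which is
  integrable on every half-line [a, infinity) because t > 0. Two barcodes with different numbers of
  bars, or with different index sets, can therefore be compared by counting, at each r, the bars
  alive there. This reduces the comparison to linear algebra at one stage at a time. The obstacle is
  then the variety of carriers: chains extended by zero, cosets of chains, and restricted functions
  on \<open>{..<n}\<close>. Dimension is therefore a relation \<open>has_dim\<close> that is moved
  along linear bijections, starting from function spaces on finite sets. A barcode has to be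
  exhibited only for the chains, where every simplex gives one bar. The barcode of the homology is a
  hypothesis of (2), and the Euler-Poincare formula at each r links the two.\<close>

section \<open>Dimension\<close>

text \<open>A relation, since \<open>vectorspace.dim\<close> is a total function whose value is
  meaningful only under \<open>fin_dim\<close>. Bundling the two lets dimensions be transported and
  compared without side conditions.\<close>

definition has_dim :: "('k, 'c) ring_scheme \<Rightarrow> ('k, 'v) module \<Rightarrow> nat \<Rightarrow> bool" where
  "has_dim K V n \<longleftrightarrow> vectorspace K V \<and> vectorspace.fin_dim K V \<and> vectorspace.dim K V = n"

lemma has_dim_unique: "has_dim K V m \<Longrightarrow> has_dim K V n \<Longrightarrow> m = n"
  by (simp add: has_dim_def)

lemma linear_map_if_linear_maps:
  assumes "field K" "module K V" "module K W" "f \<in> linear_maps K V W"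
  shows "linear_map K V W f"
proof -
  have "f \<in> module_hom K V W"
    using assms(4) by (auto simp: linear_maps_def module_hom_def)
  then show ?thesis
    using assms(1-3) by (simp add: linear_map_def vectorspace_def mod_hom_def mod_hom_axioms_def)
qed

text \<open>A subset of N that is independent in N is independent in V, hence has at most n
  elements. So a maximal independent subset of N exists, starting from the empty one, and it
  generates N.\<close>

lemma fin_dim_subspace:
  assumes "has_dim K V n" "subspace K N V"
  shows "\<exists>m. has_dim K (V\<lparr>carrier := N\<rparr>) m"
proof -
  interpret V: vectorspace K V using assms(1) by (simp add: has_dim_def)
  have sub: "submodule K N V" using assms(2) by simp
  interpret N: vectorspace K "V\<lparr>carrier := N\<rparr>" by (rule V.subspace_is_vs[OF assms(2)])
  have "finite A \<and> card A \<le> n" if "A \<subseteq> N \<and> N.lin_indpt A" for A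
  proof -
    have "V.lin_indpt A" using that V.span_li_not_depend(2)[OF _ sub] by blast
    moreover have "A \<subseteq> carrier V" using that sub by (auto simp: submodule_def)
    ultimately show ?thesis using V.li_le_dim assms(1) by (auto simp: has_dim_def)
  qed
  moreover have "{} \<subseteq> N \<and> N.lin_indpt {}" by (simp add: N.lin_dep_def)
  ultimately obtain A where "finite A" and "maximal A (\<lambda>S. S \<subseteq> N \<and> N.lin_indpt S)"
    using maximal_exists[of "\<lambda>S. S \<subseteq> N \<and> N.lin_indpt S" n "{}"] by blast
  then have "N.gen_set A" "A \<subseteq> N"
    using N.max_li_is_gen[of A] by (auto simp: maximal_def)
  then have "N.fin_dim" using \<open>finite A\<close> by (auto simp: N.fin_dim_def)
  then show ?thesis using N.vectorspace_axioms by (auto simp: has_dim_def)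
qed

text \<open>Kernel and image are given as V and W with a smaller carrier, the form in which cycles
  and boundaries appear later.\<close>

lemma rank_nullity_has_dim:
  assumes V: "has_dim K V n" and W: "module K W" and f: "f \<in> linear_maps K V W"
  obtains k l where "has_dim K (V\<lparr>carrier := {v \<in> carrier V. f v = \<zero>\<^bsub>W\<^esub>}\<rparr>) k"
    and "has_dim K (W\<lparr>carrier := f ` carrier V\<rparr>) l" and "n = k + l"
proof -
  have K: "field K" and VM: "module K V" using V by (auto simp: has_dim_def vectorspace_def)
  interpret linear_map K V W f by (rule linear_map_if_linear_maps[OF K VM W f])
  have fd: "V.fin_dim" "V.dim = n" using V by (auto simp: has_dim_def)
  obtain k where k: "has_dim K (V\<lparr>carrier := ker\<rparr>) k"
    using fin_dim_subspace[OF V kerT_is_subspace] by auto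
  have imvs: "vectorspace K (W\<lparr>carrier := im\<rparr>)" by (rule W.subspace_is_vs[OF imT_is_subspace])
  \<comment> \<open>With the codomain cut down to the image, f becomes surjective, so finite
    dimension passes from V to the image even when W is infinite-dimensional.\<close>
  have "f \<in> linear_maps K V (W\<lparr>carrier := im\<rparr>)"
    using f by (auto simp: linear_maps_def im_def)
  then interpret I: linear_map K V "W\<lparr>carrier := im\<rparr>" f
    using imvs by (intro linear_map_if_linear_maps[OF K VM]) (simp_all add: vectorspace_def)
  have "vectorspace.fin_dim K (W\<lparr>carrier := im\<rparr>)"
    using I.rank_nullity_main(2)[OF fd(1)] by (simp add: im_def)
  then have "has_dim K (W\<lparr>carrier := im\<rparr>) (vectorspace.dim K (W\<lparr>carrier := im\<rparr>))"
    using imvs by (simp add: has_dim_def)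
  moreover have "n = k + vectorspace.dim K (W\<lparr>carrier := im\<rparr>)"
    using rank_nullity[OF fd(1)] k fd(2) by (simp add: has_dim_def)
  ultimately show ?thesis using that k by (simp add: ker_def im_def)
qed

lemma linear_maps_inv_into:
  assumes V: "module K V" and f: "f \<in> linear_maps K V W"
    and bij: "bij_betw f (carrier V) (carrier W)"
  shows "inv_into (carrier V) f \<in> linear_maps K W V"
proof -
  interpret V: module K V by (rule V)
  let ?g = "inv_into (carrier V) f"
  have g: "?g y \<in> carrier V" "f (?g y) = y" if "y \<in> carrier W" for y
    using that bij by (auto simp: bij_betw_def f_inv_into_f inv_into_into)
  have gf: "?g (f x) = x" if "x \<in> carrier V" for x
    using that bij by (simp add: bij_betw_def)
  have "?g (x \<oplus>\<^bsub>W\<^esub> y) = ?g x \<oplus>\<^bsub>V\<^esub> ?g y" if "x \<in> carrier W" "y \<in> carrier W" for x y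
  proof -
    have "x \<oplus>\<^bsub>W\<^esub> y = f (?g x \<oplus>\<^bsub>V\<^esub> ?g y)" using f g that by (simp add: linear_maps_def)
    then show ?thesis using gf g that by simp
  qed
  moreover have "?g (c \<odot>\<^bsub>W\<^esub> x) = c \<odot>\<^bsub>V\<^esub> ?g x" if "c \<in> carrier K" "x \<in> carrier W" for c x
  proof -
    have "c \<odot>\<^bsub>W\<^esub> x = f (c \<odot>\<^bsub>V\<^esub> ?g x)" using f g that by (simp add: linear_maps_def)
    then show ?thesis using gf g that by simp
  qed
  ultimately show ?thesis using g by (auto simp: linear_maps_def)
qed

lemma has_dim_bij_betw:
  assumes V: "has_dim K V n" and W: "module K W" and f: "f \<in> linear_maps K V W"
    and bij: "bij_betw f (carrier V) (carrier W)"
  shows "has_dim K W n"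
proof -
  have K: "field K" and VM: "module K V" using V by (auto simp: has_dim_def vectorspace_def)
  interpret linear_map K V W f by (rule linear_map_if_linear_maps[OF K VM W f])
  have fd: "V.fin_dim" "V.dim = n" using V by (auto simp: has_dim_def)
  have "W.fin_dim" "V.dim = W.dim"
    using rank_nullity_main(2)[OF fd(1)] dim_eq[OF fd(1)] bij by (auto simp: bij_betw_def)
  then show ?thesis using fd W.vectorspace_axioms by (simp add: has_dim_def)
qed

text \<open>For barcodes the direction from W back to V matters: the isomorphism goes from M to the
  sum of interval modules, and the dimension is known at its target.\<close>

lemma has_dim_bij_betw_iff:
  assumes "module K V" "module K W" "f \<in> linear_maps K V W"
    and "bij_betw f (carrier V) (carrier W)"
  shows "has_dim K V n \<longleftrightarrow> has_dim K W n"
  using has_dim_bij_betw[OF _ assms(2-4)]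
    has_dim_bij_betw[OF _ assms(1) linear_maps_inv_into[OF assms(1,3,4)] bij_betw_inv_into[OF assms(4)]]
  by blast

lemma (in cring) finsum_func_space_apply:
  assumes "finite A" "f \<in> A \<rightarrow> carrier (func_space S)" "x \<in> S"
  shows "finsum (func_space S) f A x = (\<Oplus>v\<in>A. f v x)"
  using assms
proof (induction A)
  case empty
  interpret F: module R "func_space S" by (rule func_space_is_module)
  have "finsum (func_space S) f {} = \<zero>\<^bsub>func_space S\<^esub>" by simp
  then show ?case using empty by (simp add: func_space_def)
next
  case (insert a A)
  interpret F: module R "func_space S" by (rule func_space_is_module)
  have "finsum (func_space S) f (insert a A) = f a \<oplus>\<^bsub>func_space S\<^esub> finsum (func_space S) f A"
    using insert by (intro F.M.finsum_insert) auto
  moreover have "(\<Oplus>v\<in>insert a A. f v x) = f a x \<oplus> (\<Oplus>v\<in>A. f v x)"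
    using insert by (intro finsum_insert) (auto simp: func_space_def Pi_iff PiE_iff)
  moreover have "(g \<oplus>\<^bsub>func_space S\<^esub> h) x = g x \<oplus> h x" for g h
    using insert.prems by (simp add: func_space_def)
  ultimately show ?case using insert by simp
qed

text \<open>The indicator functions \<open>e j\<close> form a basis, because the j-th coordinate of
  a linear combination is the coefficient of \<open>e j\<close> (fact \<open>coord\<close>). These
  spaces are the models from which the explicit dimensions below are transported.\<close>

lemma (in field) has_dim_func_space:
  assumes J: "finite J"
  shows "has_dim R (func_space J) (card J)"
proof -
  interpret F: module R "func_space J" by (rule func_space_is_module)
  have "field R" by (rule field_axioms)
  then interpret F: vectorspace R "func_space J"
    using F.module_axioms by (simp add: vectorspace_def)
  define e where "e = (\<lambda>j. \<lambda>i\<in>J. if i = j then \<one> else \<zero>)"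
  have e_apply: "e i j = (if j = i then \<one> else \<zero>)" if "j \<in> J" for i j
    using that by (simp add: e_def)
  have e: "e ` J \<subseteq> carrier (func_space J)" by (auto simp: e_def func_space_def)
  have inj: "inj_on e J"
  proof (rule inj_onI)
    fix i j assume "i \<in> J" "j \<in> J" "e i = e j"
    then have "e i i = e j i" by simp
    then show "i = j" using \<open>i \<in> J\<close> by (auto simp: e_def split: if_splits)
  qed
  have coord: "F.lincomb a (e ` J) j = a (e j)" if a: "a \<in> e ` J \<rightarrow> carrier R" and j: "j \<in> J" for a j
  proof -
    have "F.lincomb a (e ` J) j = (\<Oplus>v\<in>e ` J. (a v \<odot>\<^bsub>func_space J\<^esub> v) j)"
      unfolding F.lincomb_def
      using J e a j by (intro finsum_func_space_apply) (auto simp: Pi_iff)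
    also have "\<dots> = (\<Oplus>i\<in>J. (a (e i) \<odot>\<^bsub>func_space J\<^esub> e i) j)"
      using e a j inj by (intro finsum_reindex) (auto simp: func_space_def Pi_iff PiE_iff)
    also have "\<dots> = (\<Oplus>i\<in>J. if i = j then a (e i) else \<zero>)"
    proof (intro finsum_cong')
      fix i assume i: "i \<in> J"
      then have "a (e i) \<in> carrier R" using a by blast
      then show "(a (e i) \<odot>\<^bsub>func_space J\<^esub> e i) j = (if i = j then a (e i) else \<zero>)"
        using i j by (cases "i = j") (simp_all add: func_space_def e_apply)
    qed (use a in auto)
    also have "\<dots> = a (e j)" using a j J by (intro add.finprod_singleton_swap) auto
    finally show ?thesis .
  qed
  have "F.basis (e ` J)"
  proof (subst F.basis_criterion[OF _ e]; (intro allI impI)?)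
    show "finite (e ` J)" using J by simp
    fix v assume v: "v \<in> carrier (func_space J)"
    let ?a = "\<lambda>w\<in>e ` J. v (inv_into J e w)"
    have a: "?a \<in> e ` J \<rightarrow>\<^sub>E carrier R" using v inj by (auto simp: func_space_def)
    show "\<exists>!a. a \<in> e ` J \<rightarrow>\<^sub>E carrier R \<and> F.lincomb a (e ` J) = v"
    proof (rule ex1I[of _ ?a])
      have "F.lincomb ?a (e ` J) = v"
      proof (rule PiE_ext)
        show "F.lincomb ?a (e ` J) \<in> J \<rightarrow>\<^sub>E carrier R"
          using F.lincomb_closed[OF e] a by (auto simp: func_space_def PiE_def)
        show "v \<in> J \<rightarrow>\<^sub>E carrier R" using v by (simp add: func_space_def)
        show "F.lincomb ?a (e ` J) j = v j" if "j \<in> J" for j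
          using coord[OF _ that, of ?a] a that inj by (auto simp: PiE_def)
      qed
      then show "?a \<in> e ` J \<rightarrow>\<^sub>E carrier R \<and> F.lincomb ?a (e ` J) = v" using a by simp
      fix b assume b: "b \<in> e ` J \<rightarrow>\<^sub>E carrier R \<and> F.lincomb b (e ` J) = v"
      show "b = ?a"
      proof (rule PiE_ext)
        show "b \<in> e ` J \<rightarrow>\<^sub>E carrier R" "?a \<in> e ` J \<rightarrow>\<^sub>E carrier R" using a b by auto
        show "b w = ?a w" if "w \<in> e ` J" for w
          using that coord[of b] b inj by (auto simp: PiE_def)
      qed
    qed
  qed
  then have "F.dim = card (e ` J)" "F.gen_set (e ` J)"
    using J by (auto intro!: F.dim_basis simp: F.basis_def)
  then show ?thesis
    using F.vectorspace_axioms J e inj by (auto simp: has_dim_def F.fin_dim_def card_image)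
qed

lemma has_dim_zero_space:
  assumes "has_dim K V n" "carrier V = {\<zero>\<^bsub>V\<^esub>}"
  shows "n = 0"
proof -
  interpret V: vectorspace K V using assms(1) by (simp add: has_dim_def)
  have "has_dim K V (card {})"
  proof (rule has_dim_bij_betw[OF V.has_dim_func_space V.module_axioms])
    show "(\<lambda>_. \<zero>\<^bsub>V\<^esub>) \<in> linear_maps K (V.func_space {}) V" by (simp add: linear_maps_def)
    show "bij_betw (\<lambda>_. \<zero>\<^bsub>V\<^esub>) (carrier (V.func_space {})) (carrier V)"
      by (simp add: assms(2) V.func_space_def bij_betw_def)
  qed simp
  then show ?thesis using has_dim_unique[OF assms(1)] by simp
qed

text \<open>Rank-nullity for the projection \<open>?q\<close> from Z to the cosets: its kernel is B
  and it is onto by definition. The bulk of the proof shows that the cosets form a module at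
  all.\<close>

lemma dim_subquotient:
  assumes K: "field K" and V: "module K V"
    and Z: "submodule K Z V" and B: "submodule K B V" and BZ: "B \<subseteq> Z"
    and z: "has_dim K (V\<lparr>carrier := Z\<rparr>) z"
  obtains b h where "has_dim K (V\<lparr>carrier := B\<rparr>) b" and "has_dim K (subquotient V Z B) h"
    and "z = b + h"
proof -
  interpret V: module K V by (rule V)
  interpret Z: submodule K Z V by (rule Z)
  interpret B: submodule K B V by (rule B)
  let ?q = "\<lambda>z. B +>\<^bsub>V\<^esub> z" and ?Q = "subquotient V Z B"
  have BV: "x \<in> carrier V" if "x \<in> B" for x using that B.subset by blast
  have ZV: "x \<in> carrier V" if "x \<in> Z" for x using that Z.subset by blast
  have neg: "\<ominus>\<^bsub>V\<^esub> x \<in> B" if "x \<in> B" for x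
    using B.smult_closed[of "\<ominus>\<^bsub>K\<^esub> \<one>\<^bsub>K\<^esub>" x] that BV[OF that] V.smult_minus_1[of x] by simp
  have q: "?q x = {b \<oplus>\<^bsub>V\<^esub> x | b. b \<in> B}" for x by (auto simp: a_r_coset_def')
  have Q: "carrier ?Q = ?q ` Z" "\<zero>\<^bsub>?Q\<^esub> = B" "C \<oplus>\<^bsub>?Q\<^esub> D = C <+>\<^bsub>V\<^esub> D"
    "a \<odot>\<^bsub>?Q\<^esub> C = B <+>\<^bsub>V\<^esub> ((\<lambda>c. a \<odot>\<^bsub>V\<^esub> c) ` C)" for C D a
    by (simp_all add: subquotient_def vec_space_def)
  have q_add: "?q (x \<oplus>\<^bsub>V\<^esub> y) = ?q x \<oplus>\<^bsub>?Q\<^esub> ?q y" if "x \<in> Z" "y \<in> Z" for x y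
  proof (intro equalityI subsetI)
    fix v assume "v \<in> ?q (x \<oplus>\<^bsub>V\<^esub> y)"
    then obtain b where b: "b \<in> B" "v = b \<oplus>\<^bsub>V\<^esub> (x \<oplus>\<^bsub>V\<^esub> y)" by (auto simp: q)
    then have "v = (b \<oplus>\<^bsub>V\<^esub> x) \<oplus>\<^bsub>V\<^esub> (\<zero>\<^bsub>V\<^esub> \<oplus>\<^bsub>V\<^esub> y)" using that ZV BV by (simp add: V.a_assoc)
    then show "v \<in> ?q x \<oplus>\<^bsub>?Q\<^esub> ?q y" using b B.zero_closed unfolding Q set_add_def' q by blast
  next
    fix v assume "v \<in> ?q x \<oplus>\<^bsub>?Q\<^esub> ?q y"
    then obtain b c where b: "b \<in> B" "c \<in> B" "v = (b \<oplus>\<^bsub>V\<^esub> x) \<oplus>\<^bsub>V\<^esub> (c \<oplus>\<^bsub>V\<^esub> y)"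
      unfolding Q set_add_def' q by blast
    then have "v = (b \<oplus>\<^bsub>V\<^esub> c) \<oplus>\<^bsub>V\<^esub> (x \<oplus>\<^bsub>V\<^esub> y)"
      using that ZV BV by (simp add: V.a_assoc V.a_comm V.a_lcomm)
    then show "v \<in> ?q (x \<oplus>\<^bsub>V\<^esub> y)" using b B.m_closed unfolding q by blast
  qed
  have q_smult: "?q (a \<odot>\<^bsub>V\<^esub> x) = a \<odot>\<^bsub>?Q\<^esub> ?q x" if a: "a \<in> carrier K" and x: "x \<in> Z" for a x
  proof (intro equalityI subsetI)
    fix v assume "v \<in> ?q (a \<odot>\<^bsub>V\<^esub> x)"
    then obtain b where b: "b \<in> B" "v = b \<oplus>\<^bsub>V\<^esub> a \<odot>\<^bsub>V\<^esub> x" by (auto simp: q)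
    then have "v = b \<oplus>\<^bsub>V\<^esub> a \<odot>\<^bsub>V\<^esub> (\<zero>\<^bsub>V\<^esub> \<oplus>\<^bsub>V\<^esub> x)" using x ZV by simp
    then show "v \<in> a \<odot>\<^bsub>?Q\<^esub> ?q x" using b B.zero_closed unfolding Q set_add_def' q by blast
  next
    fix v assume "v \<in> a \<odot>\<^bsub>?Q\<^esub> ?q x"
    then obtain b c where b: "b \<in> B" "c \<in> B" "v = b \<oplus>\<^bsub>V\<^esub> a \<odot>\<^bsub>V\<^esub> (c \<oplus>\<^bsub>V\<^esub> x)"
      unfolding Q set_add_def' q by blast
    then have "v = (b \<oplus>\<^bsub>V\<^esub> a \<odot>\<^bsub>V\<^esub> c) \<oplus>\<^bsub>V\<^esub> a \<odot>\<^bsub>V\<^esub> x"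
      using a x ZV BV by (simp add: V.smult_r_distr V.a_assoc)
    moreover have "b \<oplus>\<^bsub>V\<^esub> a \<odot>\<^bsub>V\<^esub> c \<in> B" using a b by simp
    ultimately show "v \<in> ?q (a \<odot>\<^bsub>V\<^esub> x)" unfolding q by blast
  qed
  have q_B: "?q x = B" if x: "x \<in> B" for x
  proof (intro equalityI subsetI)
    fix v assume "v \<in> ?q x"
    then show "v \<in> B" using x by (auto simp: q)
  next
    fix v assume v: "v \<in> B"
    have "v = (v \<oplus>\<^bsub>V\<^esub> \<ominus>\<^bsub>V\<^esub> x) \<oplus>\<^bsub>V\<^esub> x" using x v BV by (simp add: V.a_assoc V.l_neg)
    moreover have "v \<oplus>\<^bsub>V\<^esub> \<ominus>\<^bsub>V\<^esub> x \<in> B" using x v neg by simp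
    ultimately show "v \<in> ?q x" unfolding q by blast
  qed
  \<comment> \<open>B is the zero of the quotient, so this identifies the kernel of the
    projection.\<close>
  have q_B_iff: "?q x = B \<longleftrightarrow> x \<in> B" if x: "x \<in> Z" for x
  proof
    assume "?q x = B"
    moreover have "\<zero>\<^bsub>V\<^esub> \<oplus>\<^bsub>V\<^esub> x \<in> ?q x" unfolding q using B.zero_closed by blast
    ultimately show "x \<in> B" using x ZV by simp
  qed (rule q_B)
  \<comment> \<open>Every module law is inherited from V: \<open>im\<close> writes each coset as
    \<open>?q x\<close> with x in Z, and \<open>sym\<close> pulls the operations inside
    \<open>?q\<close>, where the law of V applies.\<close>
  have modQ: "module K ?Q"
  proof (rule module_criteria[OF V.R.is_cring])
    have im: "P v" if "v \<in> carrier ?Q" "\<And>x. x \<in> Z \<Longrightarrow> P (?q x)" for P v using that by (auto simp: Q)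
    have zero: "\<zero>\<^bsub>?Q\<^esub> = ?q \<zero>\<^bsub>V\<^esub>" using q_B[OF B.zero_closed] by (simp add: Q)
    have qQ: "?q x \<in> carrier ?Q" if "x \<in> Z" for x using that by (simp add: Q)
    note sym = q_add[symmetric] q_smult[symmetric] zero
    show "\<zero>\<^bsub>?Q\<^esub> \<in> carrier ?Q" using qQ by (simp add: zero)
    show "\<forall>v w. v \<in> carrier ?Q \<and> w \<in> carrier ?Q \<longrightarrow> v \<oplus>\<^bsub>?Q\<^esub> w \<in> carrier ?Q"
      by (intro allI impI, elim conjE im) (simp add: sym qQ)
    show "\<forall>v\<in>carrier ?Q. \<exists>w\<in>carrier ?Q. v \<oplus>\<^bsub>?Q\<^esub> w = \<zero>\<^bsub>?Q\<^esub>"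
    proof (intro ballI, elim im)
      fix x assume x: "x \<in> Z"
      have "\<ominus>\<^bsub>V\<^esub> x \<in> Z"
        using Z.smult_closed[of "\<ominus>\<^bsub>K\<^esub> \<one>\<^bsub>K\<^esub>" x] x ZV[OF x] V.smult_minus_1[of x] by simp
      then show "\<exists>w\<in>carrier ?Q. ?q x \<oplus>\<^bsub>?Q\<^esub> w = \<zero>\<^bsub>?Q\<^esub>"
        using x ZV by (intro bexI[of _ "?q (\<ominus>\<^bsub>V\<^esub> x)"]) (simp_all add: sym qQ V.r_neg)
    qed
    show "\<forall>c v. c \<in> carrier K \<and> v \<in> carrier ?Q \<longrightarrow> c \<odot>\<^bsub>?Q\<^esub> v \<in> carrier ?Q"
      by (intro allI impI, elim conjE im) (simp add: sym qQ)
    show "\<forall>v w. v \<in> carrier ?Q \<and> w \<in> carrier ?Q \<longrightarrow> v \<oplus>\<^bsub>?Q\<^esub> w = w \<oplus>\<^bsub>?Q\<^esub> v"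
      by (intro allI impI, elim conjE im) (simp add: sym ZV V.a_comm)
    show "\<forall>v w x. v \<in> carrier ?Q \<and> w \<in> carrier ?Q \<and> x \<in> carrier ?Q \<longrightarrow>
        (v \<oplus>\<^bsub>?Q\<^esub> w) \<oplus>\<^bsub>?Q\<^esub> x = v \<oplus>\<^bsub>?Q\<^esub> (w \<oplus>\<^bsub>?Q\<^esub> x)"
      by (intro allI impI, elim conjE im) (simp add: sym ZV V.a_assoc)
    show "\<forall>v\<in>carrier ?Q. v \<oplus>\<^bsub>?Q\<^esub> \<zero>\<^bsub>?Q\<^esub> = v"
      by (intro ballI, elim im) (simp add: sym ZV)
    show "\<forall>a b v. a \<in> carrier K \<and> b \<in> carrier K \<and> v \<in> carrier ?Q \<longrightarrow>
        (a \<otimes>\<^bsub>K\<^esub> b) \<odot>\<^bsub>?Q\<^esub> v = a \<odot>\<^bsub>?Q\<^esub> (b \<odot>\<^bsub>?Q\<^esub> v)"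
      by (intro allI impI, elim conjE im) (simp add: sym ZV V.smult_assoc1)
    show "\<forall>v\<in>carrier ?Q. \<one>\<^bsub>K\<^esub> \<odot>\<^bsub>?Q\<^esub> v = v"
      by (intro ballI, elim im) (simp add: sym ZV)
    show "\<forall>a b v. a \<in> carrier K \<and> b \<in> carrier K \<and> v \<in> carrier ?Q \<longrightarrow>
        (a \<oplus>\<^bsub>K\<^esub> b) \<odot>\<^bsub>?Q\<^esub> v = a \<odot>\<^bsub>?Q\<^esub> v \<oplus>\<^bsub>?Q\<^esub> b \<odot>\<^bsub>?Q\<^esub> v"
      by (intro allI impI, elim conjE im) (simp add: sym ZV V.smult_l_distr)
    show "\<forall>a v w. a \<in> carrier K \<and> v \<in> carrier ?Q \<and> w \<in> carrier ?Q \<longrightarrow>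
        a \<odot>\<^bsub>?Q\<^esub> (v \<oplus>\<^bsub>?Q\<^esub> w) = a \<odot>\<^bsub>?Q\<^esub> v \<oplus>\<^bsub>?Q\<^esub> a \<odot>\<^bsub>?Q\<^esub> w"
      by (intro allI impI, elim conjE im) (simp add: sym ZV V.smult_r_distr)
  qed
  have "?q \<in> linear_maps K (V\<lparr>carrier := Z\<rparr>) ?Q"
    using q_add q_smult by (simp add: linear_maps_def Q(1))
  from rank_nullity_has_dim[OF z modQ this] obtain k l
    where k: "has_dim K (V\<lparr>carrier := Z, carrier := {v \<in> Z. ?q v = \<zero>\<^bsub>?Q\<^esub>}\<rparr>) k"
      and l: "has_dim K (?Q\<lparr>carrier := ?q ` Z\<rparr>) l" and kl: "z = k + l"
    by auto
  have "{v \<in> Z. ?q v = \<zero>\<^bsub>?Q\<^esub>} = B" using q_B_iff BZ by (auto simp: Q)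
  then have "has_dim K (V\<lparr>carrier := B\<rparr>) k" using k by simp
  moreover have "has_dim K ?Q l" using l by (simp add: subquotient_def vec_space_def)
  ultimately show ?thesis using that kl by blast
qed

section \<open>Sums over bars\<close>

text \<open>An antiderivative in r is \<open>- exp (- r * t)\<close>. On a half-line the boundary
  term at infinity vanishes because t > 0, in agreement with the convention
  \<open>exp_neg \<infinity> t = 0\<close>.\<close>

lemma bar_has_integral:
  fixes a t :: real and b :: ereal
  assumes t: "t > 0" and ab: "ereal a < b"
  shows "((\<lambda>r. of_bool (a \<le> r \<and> ereal r < b) * (t * exp (- r * t))) has_integral
    exp_neg (ereal a) t - exp_neg b t) UNIV"
proof (cases b)
  case (real c)
  have "((\<lambda>r. t * exp (- r * t)) has_integral - exp (- c * t) - - exp (- a * t)) {a..c}"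
    using ab real
    by (intro fundamental_theorem_of_calculus)
      (auto simp flip: has_real_derivative_iff_has_vector_derivative intro!: derivative_eq_intros)
  \<comment> \<open>Bars are half-open while the fundamental theorem speaks of closed intervals; the
    two differ by the negligible set \<open>{c}\<close>.\<close>
  then have "((\<lambda>r. t * exp (- r * t)) has_integral exp (- a * t) - exp (- c * t)) {a..<c}"
    by (subst has_integral_spike_set_eq[of _ "{a..c}"])
      (auto intro: negligible_subset[of "{c}"])
  then have "((\<lambda>r. if r \<in> {a..<c} then t * exp (- r * t) else 0) has_integral
      exp (- a * t) - exp (- c * t)) UNIV"
    by (subst has_integral_restrict_UNIV)
  then show ?thesis
    by (rule has_integral_eq_rhs[OF has_integral_eq, rotated]) (auto simp: exp_neg_def real)
next
  case PInf
  have "((\<lambda>r. t * exp (- t * r)) has_integral t * (exp (- t * a) / t)) {a..}"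
    by (intro has_integral_mult_right has_integral_exp_minus_to_infinity t)
  then have "((\<lambda>r. t * exp (- r * t)) has_integral exp (- a * t)) {a..}"
    using t by (simp add: mult.commute)
  then have "((\<lambda>r. if r \<in> {a..} then t * exp (- r * t) else 0) has_integral exp (- a * t)) UNIV"
    by (subst has_integral_restrict_UNIV)
  then show ?thesis
    by (rule has_integral_eq_rhs[OF has_integral_eq, rotated]) (auto simp: exp_neg_def PInf)
qed (use ab in auto)

text \<open>Both sides are integrals of the same function. The weights and both index types are
  general because the lemma serves twice: with unit weights for two barcodes of one module, and with
  signs for homology bars against subsets of X.\<close>

lemma bar_sum_cong:
  fixes u :: "'i \<Rightarrow> real" and v :: "'j \<Rightarrow> real"
  assumes t: "t > 0" and fin: "finite I" "finite J"
    and ab: "\<And>i. i \<in> I \<Longrightarrow> ereal (a i) < b i" and cd: "\<And>j. j \<in> J \<Longrightarrow> ereal (c j) < d j"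
    and eq: "\<And>r. (\<Sum>i\<in>I. u i * of_bool (a i \<le> r \<and> ereal r < b i)) =
                 (\<Sum>j\<in>J. v j * of_bool (c j \<le> r \<and> ereal r < d j))"
  shows "(\<Sum>i\<in>I. u i * (exp_neg (ereal (a i)) t - exp_neg (b i) t)) =
         (\<Sum>j\<in>J. v j * (exp_neg (ereal (c j)) t - exp_neg (d j) t))"
proof -
  have *: "((\<lambda>r. (\<Sum>i\<in>I. u i * of_bool (a i \<le> r \<and> ereal r < b i)) * (t * exp (- r * t))) has_integral
      (\<Sum>i\<in>I. u i * (exp_neg (ereal (a i)) t - exp_neg (b i) t))) UNIV"
    if "finite I" "\<And>i. i \<in> I \<Longrightarrow> ereal (a i) < b i" for I :: "'x set" and u a b
    unfolding sum_distrib_right mult.assoc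
    using that by (intro has_integral_sum has_integral_mult_right bar_has_integral t) auto
  show ?thesis
    by (rule has_integral_unique[OF *[OF fin(1) ab]])
      (simp_all only: eq *[OF fin(2) cd])
qed

section \<open>Alternating sums and Euler characteristics of finite complexes\<close>

lemma sum_alternating_card_eq_1:
  assumes "finite X" "X \<noteq> {}"
  shows "(\<Sum>A | A \<subseteq> X \<and> A \<noteq> {}. (- 1) ^ (card A - 1)) = (1 :: real)"
proof -
  \<comment> \<open>Expansion of the product of \<open>1 - 1\<close> over X, which is zero because X
    is nonempty. The empty set contributes 1, so the other subsets sum to -1; lowering the exponent
    from \<open>card A\<close> to \<open>card A - 1\<close> flips the sign.\<close>
  have "(\<Sum>A\<in>Pow X. (- 1) ^ card A) = (\<Prod>x\<in>X. 1 - (1 :: real))"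
    using assms by (subst prod_diff_conv_sum) simp_all
  also have "\<dots> = 0" using assms by (simp add: card_gt_0_iff)
  finally have "(\<Sum>A\<in>Pow X - {{}}. (- 1) ^ card A) = (- 1 :: real)"
    using assms by (simp add: sum.remove[of _ "{}"])
  also have "Pow X - {{}} = {A. A \<subseteq> X \<and> A \<noteq> {}}" by auto
  also have "(\<Sum>A | A \<subseteq> X \<and> A \<noteq> {}. (- 1 :: real) ^ card A) =
      - (\<Sum>A | A \<subseteq> X \<and> A \<noteq> {}. (- 1) ^ (card A - 1))"
    unfolding sum_negf[symmetric]
  proof (intro sum.cong refl)
    fix A assume "A \<in> {A. A \<subseteq> X \<and> A \<noteq> {}}"
    then have "card A = Suc (card A - 1)"
      using assms finite_subset[of A X] by (simp add: card_gt_0_iff)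
    then show "(- 1 :: real) ^ card A = - ((- 1) ^ (card A - 1))" by (metis mult_minus1 power_Suc)
  qed
  finally show ?thesis by simp
qed

text \<open>A k-simplex has k + 1 vertices, so only degrees below N occur. A range that is
  independent of S allows the same degrees to be used for every stage and for homology.\<close>

lemma euler_characteristic_eq_sum_lessThan:
  assumes "\<And>\<sigma>. \<sigma> \<in> S \<Longrightarrow> card \<sigma> \<le> N"
  shows "euler_characteristic S = (\<Sum>k<N. (- 1) ^ k * int (card (simplices S k)))"
  unfolding euler_characteristic_def
proof (rule sum.mono_neutral_left)
  show "{k. simplices S k \<noteq> {}} \<subseteq> {..<N}" using assms by (force simp: simplices_def)
qed auto

lemma sum_simplices:
  fixes g :: "'a set \<Rightarrow> 'b::comm_monoid_add"
  assumes S: "finite S" "\<And>\<sigma>. \<sigma> \<in> S \<Longrightarrow> finite \<sigma> \<and> \<sigma> \<noteq> {}"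
  shows "(\<Sum>\<sigma>\<in>S. g \<sigma>) = (\<Sum>k | simplices S k \<noteq> {}. \<Sum>\<sigma>\<in>simplices S k. g \<sigma>)"
proof -
  have pos: "card \<sigma> > 0" if "\<sigma> \<in> S" for \<sigma> using S that by (simp add: card_gt_0_iff)
  have eq: "{\<sigma> \<in> S. card \<sigma> - 1 = k} = simplices S k" for k
    using pos by (force simp: simplices_def)
  have "{k. simplices S k \<noteq> {}} = (\<lambda>\<sigma>. card \<sigma> - 1) ` S"
    unfolding eq[symmetric] by auto
  then have "(\<Sum>\<sigma>\<in>S. g \<sigma>) = (\<Sum>k | simplices S k \<noteq> {}. \<Sum>\<sigma> | \<sigma> \<in> S \<and> card \<sigma> - 1 = k. g \<sigma>)"
    using S by (subst sum.group) auto
  then show ?thesis by (simp only: eq)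
qed

lemma euler_characteristic_eq_sum_simplices:
  assumes "finite S" "\<And>\<sigma>. \<sigma> \<in> S \<Longrightarrow> finite \<sigma> \<and> \<sigma> \<noteq> {}"
  shows "euler_characteristic S = (\<Sum>\<sigma>\<in>S. (- 1) ^ (card \<sigma> - 1))"
  by (simp add: sum_simplices[OF assms] euler_characteristic_def) (simp add: simplices_def mult.commute)

section \<open>Diameters of finite sets and the Euler characteristics of the Rips stages\<close>

lemma diameter_mono_finite:
  fixes A B :: "'a::metric_space set"
  assumes "finite B" "A \<subseteq> B"
  shows "diameter A \<le> diameter B"
  using assms by (intro diameter_subset finite_imp_bounded)

lemma diameter_attained_finite:
  fixes A :: "'a::metric_space set"
  assumes "finite A" "A \<noteq> {}"
  obtains x y where "x \<in> A" "y \<in> A" "diameter A = dist x y"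
  using diameter_compact_attained[of A] assms finite_imp_compact by metis

lemma diameter_nonneg_finite:
  fixes A :: "'a::metric_space set"
  assumes "finite A"
  shows "diameter A \<ge> 0"
  using diameter_mono_finite[OF assms, of "{}"] by simp

text \<open>This singles out the summands of (1) that survive as t tends to infinity.\<close>

lemma diameter_eq_0_iff_finite:
  fixes A :: "'a::metric_space set"
  assumes "finite A" "A \<noteq> {}"
  shows "diameter A = 0 \<longleftrightarrow> card A = 1"
proof
  assume "diameter A = 0"
  then have "x = y" if "x \<in> A" "y \<in> A" for x y
    using diameter_bounded_bound[OF finite_imp_bounded[OF assms(1)] that] by simp
  then obtain x where "A = {x}" using assms(2) by blast
  then show "card A = 1" by simp
next
  assume "card A = 1"
  then show "diameter A = 0" by (auto simp: card_1_singleton_iff)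
qed

lemma finite_rips: "finite X \<Longrightarrow> finite (rips X r)"
  by (rule finite_subset[of _ "Pow X"]) (auto simp: rips_def)

lemma rips_downward_closed:
  assumes "finite X" "\<sigma> \<in> rips X r" "\<tau> \<subseteq> \<sigma>" "\<tau> \<noteq> {}"
  shows "\<tau> \<in> rips X r"
proof -
  have "finite \<sigma>" using assms by (auto simp: rips_def intro: finite_subset)
  from diameter_mono_finite[OF this assms(3)] show ?thesis using assms by (auto simp: rips_def)
qed

text \<open>Over an index set that does not depend on r, the Euler characteristic becomes a signed
  step function in which each A switches on at its diameter, that is, a sum over the bars
  \<open>[diameter A, \<infinity>)\<close>.\<close>

lemma euler_characteristic_rips:
  assumes X: "finite X"
  shows "euler_characteristic (rips X r) =
    (\<Sum>A | A \<subseteq> X \<and> A \<noteq> {}. (- 1) ^ (card A - 1) * of_bool (diameter A \<le> r))"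
proof -
  have "euler_characteristic (rips X r) = (\<Sum>\<sigma>\<in>rips X r. (- 1) ^ (card \<sigma> - 1))"
    using X by (intro euler_characteristic_eq_sum_simplices finite_rips)
      (auto simp: rips_def intro: finite_subset)
  also have "\<dots> = (\<Sum>A | A \<subseteq> X \<and> A \<noteq> {}. (- 1) ^ (card A - 1) * of_bool (diameter A \<le> r))"
    using X by (intro sum.mono_neutral_cong_left) (auto simp: rips_def)
  finally show ?thesis .
qed

text \<open>After the sums are exchanged, each A is treated on its own. Its diameter is attained and
  so equals some \<open>d i\<close>; the indicator selects the indices \<open>j \<ge> i\<close>, and
  the differences collapse to \<open>e i - e (Suc n)\<close>, whose last term is zero by
  \<open>d_inf\<close>.\<close>

lemma sum_euler_characteristic_rips:
  fixes X :: "'a::metric_space set" and d :: "nat \<Rightarrow> ereal"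
  assumes X: "finite X"
    and mono: "strict_mono_on {0..n} d"
    and d: "d ` {0..n} = {ereal (dist x y) | x y. x \<in> X \<and> y \<in> X}"
    and d_inf: "d (n + 1) = \<infinity>"
  shows "(\<Sum>j = 0..n. of_int (euler_characteristic (rips X (real_of_ereal (d j)))) *
             (exp_neg (d j) t - exp_neg (d (j + 1)) t)) =
         (\<Sum>A | A \<subseteq> X \<and> A \<noteq> {}. (- 1) ^ (card A - 1) * exp (- diameter A * t))"
proof -
  define e where "e = (\<lambda>j. exp_neg (d j) t)"
  define D where "D = (\<lambda>j. real_of_ereal (d j))"
  \<comment> \<open>Up to n the values of d are distances, hence finite, so nothing is lost under
    \<open>real_of_ereal\<close>.\<close>
  have dD: "d j = ereal (D j)" if "j \<le> n" for j
  proof -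
    have "d j \<in> d ` {0..n}" using that by simp
    then show ?thesis unfolding d D_def by auto
  qed
  have tel: "(\<Sum>j = 0..n. of_bool (diameter A \<le> D j) * (e j - e (j + 1))) = exp (- diameter A * t)"
    if A: "A \<subseteq> X" "A \<noteq> {}" for A
  proof -
    obtain x y where "x \<in> A" "y \<in> A" "diameter A = dist x y"
      using diameter_attained_finite[of A] A X finite_subset by blast
    then have "ereal (diameter A) \<in> d ` {0..n}" unfolding d using A by auto
    then obtain i where i: "i \<le> n" "d i = ereal (diameter A)" by force
    have iff: "diameter A \<le> D j \<longleftrightarrow> i \<le> j" if "j \<le> n" for j
    proof -
      have "diameter A \<le> D j \<longleftrightarrow> d i \<le> d j" using i dD[OF that] by simp
      also have "\<dots> \<longleftrightarrow> i \<le> j"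
        using strict_mono_on_less_eq[OF mono, of i j] i that by simp
      finally show ?thesis .
    qed
    have "(\<Sum>j = 0..n. of_bool (diameter A \<le> D j) * (e j - e (j + 1))) = (\<Sum>j = i..n. e j - e (j + 1))"
      using iff by (intro sum.mono_neutral_cong_right) auto
    also have "\<dots> = - (\<Sum>j = i..n. e (Suc j) - e j)" by (simp flip: sum_negf)
    also have "\<dots> = e i - e (Suc n)" using i by (subst sum_Suc_diff) auto
    also have "\<dots> = exp (- diameter A * t)" using i d_inf by (simp add: e_def exp_neg_def)
    finally show ?thesis .
  qed
  have "(\<Sum>j = 0..n. of_int (euler_characteristic (rips X (D j))) * (e j - e (j + 1))) =
      (\<Sum>j = 0..n. \<Sum>A | A \<subseteq> X \<and> A \<noteq> {}.
        (- 1) ^ (card A - 1) * (of_bool (diameter A \<le> D j) * (e j - e (j + 1))))"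
    by (simp add: euler_characteristic_rips[OF X] sum_distrib_right mult.assoc)
  also have "\<dots> = (\<Sum>A | A \<subseteq> X \<and> A \<noteq> {}. (- 1) ^ (card A - 1) *
      (\<Sum>j = 0..n. of_bool (diameter A \<le> D j) * (e j - e (j + 1))))"
    by (subst sum.swap) (simp only: sum_distrib_left)
  also have "\<dots> = (\<Sum>A | A \<subseteq> X \<and> A \<noteq> {}. (- 1) ^ (card A - 1) * exp (- diameter A * t))"
    using tel by (intro sum.cong refl) auto
  finally show ?thesis unfolding e_def D_def .
qed

section \<open>Limits of the alternating sum at 0 and at infinity\<close>

lemma tendsto_alternating_diameter_sum_0:
  fixes X :: "'a::metric_space set"
  assumes "finite X" "X \<noteq> {}"
  shows "((\<lambda>t. \<Sum>A | A \<subseteq> X \<and> A \<noteq> {}. (- 1) ^ (card A - 1) * exp (- diameter A * t)) \<longlongrightarrow> 1)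
    (at_right (0 :: real))"
proof -
  have "((\<lambda>t. \<Sum>A | A \<subseteq> X \<and> A \<noteq> {}. (- 1) ^ (card A - 1) * exp (- diameter A * t)) \<longlongrightarrow>
    (\<Sum>A | A \<subseteq> X \<and> A \<noteq> {}. (- 1) ^ (card A - 1) * exp (- diameter A * 0))) (at_right (0 :: real))"
    by (intro tendsto_sum tendsto_mult tendsto_const tendsto_exp tendsto_ident_at)
  then show ?thesis using sum_alternating_card_eq_1[OF assms] by simp
qed

lemma tendsto_alternating_diameter_sum_at_top:
  fixes X :: "'a::metric_space set"
  assumes X: "finite X"
  shows "((\<lambda>t. \<Sum>A | A \<subseteq> X \<and> A \<noteq> {}. (- 1) ^ (card A - 1) * exp (- diameter A * t)) \<longlongrightarrow>
    real (card X)) at_top"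
proof -
  \<comment> \<open>A singleton has diameter 0 and sign +1, so its term is constantly 1. Any other
    nonempty A has positive diameter and its term decays to 0. The limit therefore counts
    singletons.\<close>
  have lim: "((\<lambda>t. (- 1) ^ (card A - 1) * exp (- diameter A * t)) \<longlongrightarrow> of_bool (card A = 1)) at_top"
    if A: "A \<in> {A. A \<subseteq> X \<and> A \<noteq> {}}" for A
  proof -
    have fin: "finite A" "A \<noteq> {}" using A X finite_subset by auto
    show ?thesis
    proof (cases "card A = 1")
      case True
      then show ?thesis using diameter_eq_0_iff_finite[OF fin] by simp
    next
      case False
      then have "diameter A > 0"
        using diameter_eq_0_iff_finite[OF fin] diameter_nonneg_finite[OF fin(1)] by simp
      then have "((\<lambda>t. exp (- diameter A * t)) \<longlongrightarrow> 0) at_top" 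
        by (intro filterlim_compose[OF exp_at_bot]
            filterlim_tendsto_neg_mult_at_bot[OF tendsto_const _ filterlim_ident]) simp
      then show ?thesis using tendsto_mult_right_zero False by simp
    qed
  qed
  have "(\<lambda>x. {x}) ` X = {A. A \<subseteq> X \<and> card A = 1}" by (auto simp: card_1_singleton_iff)
  then have "card {A. A \<subseteq> X \<and> card A = 1} = card X"
    by (metis card_image inj_singleton)
  moreover have "{A. A \<subseteq> X \<and> A \<noteq> {}} \<inter> {A. card A = 1} = {A. A \<subseteq> X \<and> card A = 1}" by auto
  ultimately have "(\<Sum>A | A \<subseteq> X \<and> A \<noteq> {}. of_bool (card A = 1)) = real (card X)"
    using X by (subst sum_of_bool_eq) simp_all
  moreover have "((\<lambda>t. \<Sum>A | A \<subseteq> X \<and> A \<noteq> {}. (- 1) ^ (card A - 1) * exp (- diameter A * t)) \<longlongrightarrow>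
    (\<Sum>A | A \<subseteq> X \<and> A \<noteq> {}. of_bool (card A = 1))) at_top"
    by (intro tendsto_sum lim)
  ultimately show ?thesis by simp
qed

section \<open>Barcodes\<close>

lemma chain_space_simps:
  "carrier (chain_space K S k) =
     {c. (\<forall>\<sigma>\<in>simplices S k. c \<sigma> \<in> carrier K) \<and> (\<forall>\<sigma>. \<sigma> \<notin> simplices S k \<longrightarrow> c \<sigma> = \<zero>\<^bsub>K\<^esub>)}"
  "\<zero>\<^bsub>chain_space K S k\<^esub> = (\<lambda>\<sigma>. \<zero>\<^bsub>K\<^esub>)"
  "c \<oplus>\<^bsub>chain_space K S k\<^esub> d = (\<lambda>\<sigma>. c \<sigma> \<oplus>\<^bsub>K\<^esub> d \<sigma>)"
  "x \<odot>\<^bsub>chain_space K S k\<^esub> c = (\<lambda>\<sigma>. x \<otimes>\<^bsub>K\<^esub> c \<sigma>)"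
  by (simp_all add: chain_space_def vec_space_def)

lemma direct_sum_stage_simps:
  "carrier (stage (pm_direct_sum n M) r) = (\<Pi>\<^sub>E i\<in>{..<n}. carrier (stage (M i) r))"
  "\<zero>\<^bsub>stage (pm_direct_sum n M) r\<^esub> = (\<lambda>i\<in>{..<n}. \<zero>\<^bsub>stage (M i) r\<^esub>)"
  "f \<oplus>\<^bsub>stage (pm_direct_sum n M) r\<^esub> g = (\<lambda>i\<in>{..<n}. f i \<oplus>\<^bsub>stage (M i) r\<^esub> g i)"
  "c \<odot>\<^bsub>stage (pm_direct_sum n M) r\<^esub> f = (\<lambda>i\<in>{..<n}. c \<odot>\<^bsub>stage (M i) r\<^esub> f i)"
  by (simp_all add: pm_direct_sum_def vec_space_def)

lemma interval_stage_simps: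
  "carrier (stage (interval_module K a b) r) =
     (if a \<le> r \<and> ereal r < b then carrier K else {\<zero>\<^bsub>K\<^esub>})"
  "\<zero>\<^bsub>stage (interval_module K a b) r\<^esub> = \<zero>\<^bsub>K\<^esub>"
  "x \<oplus>\<^bsub>stage (interval_module K a b) r\<^esub> y = x \<oplus>\<^bsub>K\<^esub> y"
  "c \<odot>\<^bsub>stage (interval_module K a b) r\<^esub> x = c \<otimes>\<^bsub>K\<^esub> x"
  by (simp_all add: interval_module_def vec_space_def)

text \<open>Valid at every \<sigma>, since a chain takes the value zero away from the
  k-simplices.\<close>

lemma (in ring) chain_closed: "c \<in> carrier (chain_space R S k) \<Longrightarrow> c \<sigma> \<in> carrier R"
  by (cases "\<sigma> \<in> simplices S k") (auto simp: chain_space_simps)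

lemma (in cring) module_chain_space: "module R (chain_space R S k)"
proof (rule module_criteria[OF is_cring])
  show "\<forall>v\<in>carrier (chain_space R S k). \<exists>w\<in>carrier (chain_space R S k).
      v \<oplus>\<^bsub>chain_space R S k\<^esub> w = \<zero>\<^bsub>chain_space R S k\<^esub>"
  proof
    fix v assume v: "v \<in> carrier (chain_space R S k)"
    then have "v \<sigma> \<in> carrier R" for \<sigma> by (rule chain_closed)
    then show "\<exists>w\<in>carrier (chain_space R S k).
      v \<oplus>\<^bsub>chain_space R S k\<^esub> w = \<zero>\<^bsub>chain_space R S k\<^esub>"
      using v by (intro bexI[of _ "\<lambda>\<sigma>. \<ominus> v \<sigma>"]) (auto simp: chain_space_simps r_neg)
  qed
next
  note * = chain_closed[where S = S and k = k]
  show "\<forall>v w. v \<in> carrier (chain_space R S k) \<and> w \<in> carrier (chain_space R S k) \<longrightarrow>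
      v \<oplus>\<^bsub>chain_space R S k\<^esub> w = w \<oplus>\<^bsub>chain_space R S k\<^esub> v"
    using * by (auto simp: chain_space_simps(2-) a_comm)
  show "\<forall>v w x. v \<in> carrier (chain_space R S k) \<and> w \<in> carrier (chain_space R S k) \<and>
      x \<in> carrier (chain_space R S k) \<longrightarrow>
      (v \<oplus>\<^bsub>chain_space R S k\<^esub> w) \<oplus>\<^bsub>chain_space R S k\<^esub> x =
      v \<oplus>\<^bsub>chain_space R S k\<^esub> (w \<oplus>\<^bsub>chain_space R S k\<^esub> x)"
    using * by (auto simp: chain_space_simps(2-) a_assoc)
  show "\<forall>v\<in>carrier (chain_space R S k). v \<oplus>\<^bsub>chain_space R S k\<^esub> \<zero>\<^bsub>chain_space R S k\<^esub> = v"
    using * by (auto simp: chain_space_simps(2-))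
  show "\<forall>a b v. a \<in> carrier R \<and> b \<in> carrier R \<and> v \<in> carrier (chain_space R S k) \<longrightarrow>
      (a \<otimes> b) \<odot>\<^bsub>chain_space R S k\<^esub> v = a \<odot>\<^bsub>chain_space R S k\<^esub> (b \<odot>\<^bsub>chain_space R S k\<^esub> v)"
    using * by (auto simp: chain_space_simps(2-) m_assoc)
  show "\<forall>v\<in>carrier (chain_space R S k). \<one> \<odot>\<^bsub>chain_space R S k\<^esub> v = v"
    using * by (auto simp: chain_space_simps(2-))
  show "\<forall>a b v. a \<in> carrier R \<and> b \<in> carrier R \<and> v \<in> carrier (chain_space R S k) \<longrightarrow>
      (a \<oplus> b) \<odot>\<^bsub>chain_space R S k\<^esub> v =
      a \<odot>\<^bsub>chain_space R S k\<^esub> v \<oplus>\<^bsub>chain_space R S k\<^esub> b \<odot>\<^bsub>chain_space R S k\<^esub> v"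
    using * by (auto simp: chain_space_simps(2-) l_distr)
  show "\<forall>a v w. a \<in> carrier R \<and> v \<in> carrier (chain_space R S k) \<and> w \<in> carrier (chain_space R S k) \<longrightarrow>
      a \<odot>\<^bsub>chain_space R S k\<^esub> (v \<oplus>\<^bsub>chain_space R S k\<^esub> w) =
      a \<odot>\<^bsub>chain_space R S k\<^esub> v \<oplus>\<^bsub>chain_space R S k\<^esub> a \<odot>\<^bsub>chain_space R S k\<^esub> w"
    using * by (auto simp: chain_space_simps(2-) r_distr)
qed (auto simp: chain_space_simps)

text \<open>Two conventions for functions on the k-simplices are matched: chains are zero elsewhere,
  while elements of \<open>func_space\<close> are undefined elsewhere.\<close>

lemma (in field) has_dim_chain_space:
  assumes fin: "finite (simplices S k)"
  shows "has_dim R (chain_space R S k) (card (simplices S k))"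
proof (rule has_dim_bij_betw[OF has_dim_func_space[OF fin] module_chain_space])
  let ?f = "\<lambda>c \<sigma>. if \<sigma> \<in> simplices S k then c \<sigma> else \<zero>"
  show "?f \<in> linear_maps R (func_space (simplices S k)) (chain_space R S k)"
    by (auto simp: linear_maps_def func_space_def chain_space_simps fun_eq_iff PiE_iff)
  show "bij_betw ?f (carrier (func_space (simplices S k))) (carrier (chain_space R S k))"
    by (rule bij_betw_byWitness[where f' = "\<lambda>c. restrict c (simplices S k)"])
      (auto simp: func_space_def chain_space_simps fun_eq_iff PiE_iff extensional_def)
qed

section \<open>Interval modules and direct sums as persistence modules\<close>

lemma (in cring) persistence_module_interval: "persistence_module R (interval_module R a b)"
proof -
  have "module R (stage (interval_module R a b) r)" for r
  proof (rule module_criteria[OF is_cring])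
    show "\<forall>v\<in>carrier (stage (interval_module R a b) r). \<exists>w\<in>carrier (stage (interval_module R a b) r).
      v \<oplus>\<^bsub>stage (interval_module R a b) r\<^esub> w = \<zero>\<^bsub>stage (interval_module R a b) r\<^esub>"
      by (auto simp: interval_stage_simps intro!: bexI[of _ "\<ominus> _"] r_neg)
  qed (auto simp: interval_stage_simps a_assoc a_comm a_lcomm m_assoc l_distr r_distr)
  moreover have "pmap (interval_module R a b) r s \<in>
      linear_maps R (stage (interval_module R a b) r) (stage (interval_module R a b) s)" for r s
    unfolding linear_maps_def interval_stage_simps by (auto simp: interval_module_def)
  moreover have "pmap (interval_module R a b) r r x = x"
    if "x \<in> carrier (stage (interval_module R a b) r)" for r x
    using that unfolding interval_stage_simps by (auto simp: interval_module_def split: if_splits)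
  moreover have "pmap (interval_module R a b) s u (pmap (interval_module R a b) r s x) =
      pmap (interval_module R a b) r u x" if "r \<le> s" "s \<le> u" for r s u x
  proof -
    \<comment> \<open>Functoriality rests on the convexity of the bar: if r and u lie in it, so does
      s between them, and the composite does not vanish at s.\<close>
    have "ereal s < b" if "ereal u < b" using that \<open>s \<le> u\<close> le_less_trans[of "ereal s" "ereal u" b] by simp
    then show ?thesis using that by (auto simp: interval_module_def)
  qed
  ultimately show ?thesis unfolding persistence_module_def by blast
qed

lemma module_direct_sum_stage:
  assumes K: "cring K" and M: "\<And>i. i < n \<Longrightarrow> module K (stage (M i) r)"
  shows "module K (stage (pm_direct_sum n M) r)"
proof -
  have G: "abelian_group (stage (M i) r)" if "i < n" for i using M[OF that] by (simp add: module_def)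
  note [simp] = direct_sum_stage_simps
  note AM = abelian_group.axioms(1)[OF G]
  show ?thesis
  proof (rule module_criteria[OF K])
    let ?D = "stage (pm_direct_sum n M) r"
    show "\<zero>\<^bsub>?D\<^esub> \<in> carrier ?D" by (auto intro: abelian_monoid.zero_closed[OF AM])
    show "\<forall>v w. v \<in> carrier ?D \<and> w \<in> carrier ?D \<longrightarrow> v \<oplus>\<^bsub>?D\<^esub> w \<in> carrier ?D"
      by (auto simp: PiE_iff intro: abelian_monoid.a_closed[OF AM])
    show "\<forall>v\<in>carrier ?D. \<exists>w\<in>carrier ?D. v \<oplus>\<^bsub>?D\<^esub> w = \<zero>\<^bsub>?D\<^esub>"
    proof
      fix v assume "v \<in> carrier ?D"
      then show "\<exists>w\<in>carrier ?D. v \<oplus>\<^bsub>?D\<^esub> w = \<zero>\<^bsub>?D\<^esub>"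
        by (intro bexI[of _ "\<lambda>i\<in>{..<n}. \<ominus>\<^bsub>stage (M i) r\<^esub> v i"])
          (auto simp: PiE_iff fun_eq_iff intro: abelian_group.a_inv_closed[OF G] abelian_group.r_neg[OF G])
    qed
    show "\<forall>c v. c \<in> carrier K \<and> v \<in> carrier ?D \<longrightarrow> c \<odot>\<^bsub>?D\<^esub> v \<in> carrier ?D"
      by (auto simp: PiE_iff intro: module.smult_closed[OF M])
    show "\<forall>v w. v \<in> carrier ?D \<and> w \<in> carrier ?D \<longrightarrow> v \<oplus>\<^bsub>?D\<^esub> w = w \<oplus>\<^bsub>?D\<^esub> v"
      by (auto simp: PiE_iff fun_eq_iff intro: abelian_monoid.a_comm[OF AM])
    show "\<forall>v w x. v \<in> carrier ?D \<and> w \<in> carrier ?D \<and> x \<in> carrier ?D \<longrightarrow>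
        (v \<oplus>\<^bsub>?D\<^esub> w) \<oplus>\<^bsub>?D\<^esub> x = v \<oplus>\<^bsub>?D\<^esub> (w \<oplus>\<^bsub>?D\<^esub> x)"
      by (auto simp: PiE_iff fun_eq_iff abelian_monoid.a_assoc[OF AM])
    show "\<forall>v\<in>carrier ?D. v \<oplus>\<^bsub>?D\<^esub> \<zero>\<^bsub>?D\<^esub> = v"
      by (auto simp: PiE_iff fun_eq_iff extensional_def abelian_monoid.r_zero[OF AM])
    show "\<forall>a b v. a \<in> carrier K \<and> b \<in> carrier K \<and> v \<in> carrier ?D \<longrightarrow>
        (a \<otimes>\<^bsub>K\<^esub> b) \<odot>\<^bsub>?D\<^esub> v = a \<odot>\<^bsub>?D\<^esub> (b \<odot>\<^bsub>?D\<^esub> v)"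
      by (auto simp: PiE_iff fun_eq_iff module.smult_assoc1[OF M])
    show "\<forall>v\<in>carrier ?D. \<one>\<^bsub>K\<^esub> \<odot>\<^bsub>?D\<^esub> v = v"
      by (auto simp: PiE_iff fun_eq_iff extensional_def module.smult_one[OF M])
    show "\<forall>a b v. a \<in> carrier K \<and> b \<in> carrier K \<and> v \<in> carrier ?D \<longrightarrow>
        (a \<oplus>\<^bsub>K\<^esub> b) \<odot>\<^bsub>?D\<^esub> v = a \<odot>\<^bsub>?D\<^esub> v \<oplus>\<^bsub>?D\<^esub> b \<odot>\<^bsub>?D\<^esub> v"
      by (auto simp: PiE_iff fun_eq_iff module.smult_l_distr[OF M])
    show "\<forall>a v w. a \<in> carrier K \<and> v \<in> carrier ?D \<and> w \<in> carrier ?D \<longrightarrow>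
        a \<odot>\<^bsub>?D\<^esub> (v \<oplus>\<^bsub>?D\<^esub> w) = a \<odot>\<^bsub>?D\<^esub> v \<oplus>\<^bsub>?D\<^esub> a \<odot>\<^bsub>?D\<^esub> w"
      by (auto simp: PiE_iff fun_eq_iff module.smult_r_distr[OF M])
  qed
qed

lemma persistence_module_direct_sum:
  assumes K: "cring K" and M: "\<And>i. i < n \<Longrightarrow> persistence_module K (M i)"
  shows "persistence_module K (pm_direct_sum n M)"
proof -
  have pmap: "pmap (pm_direct_sum n M) r s f = (\<lambda>i\<in>{..<n}. pmap (M i) r s (f i))" for r s f
    by (simp add: pm_direct_sum_def)
  have "module K (stage (pm_direct_sum n M) r)" for r
    using M by (intro module_direct_sum_stage[OF K]) (auto simp: persistence_module_def)
  moreover have "pmap (pm_direct_sum n M) r s \<in>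
      linear_maps K (stage (pm_direct_sum n M) r) (stage (pm_direct_sum n M) s)" if "r \<le> s" for r s
  proof -
    have "pmap (M i) r s \<in> linear_maps K (stage (M i) r) (stage (M i) s)" if "i < n" for i
      using M[OF that] \<open>r \<le> s\<close> by (simp add: persistence_module_def)
    then show ?thesis
      by (auto simp: linear_maps_def pmap direct_sum_stage_simps PiE_iff Pi_iff fun_eq_iff)
  qed
  moreover have "pmap (pm_direct_sum n M) r r f = f"
    if "f \<in> carrier (stage (pm_direct_sum n M) r)" for r f
    using that M
    by (auto simp: pmap direct_sum_stage_simps persistence_module_def PiE_iff fun_eq_iff extensional_def)
  moreover have "pmap (pm_direct_sum n M) s u (pmap (pm_direct_sum n M) r s f) =
      pmap (pm_direct_sum n M) r u f"
    if "r \<le> s" "s \<le> u" "f \<in> carrier (stage (pm_direct_sum n M) r)" for r s u f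
    using that M
    by (auto simp: pmap direct_sum_stage_simps persistence_module_def PiE_iff fun_eq_iff)
  ultimately show ?thesis unfolding persistence_module_def by blast
qed

section \<open>Bars alive at a stage, and well-definedness of the magnitude\<close>

lemma (in field) has_dim_bars_stage:
  "has_dim R (stage (pm_direct_sum n (\<lambda>i. interval_module R (a i) (b i))) r)
     (card {i. i < n \<and> a i \<le> r \<and> ereal r < b i})"
proof -
  define J where "J = {i. i < n \<and> a i \<le> r \<and> ereal r < b i}"
  let ?D = "stage (pm_direct_sum n (\<lambda>i. interval_module R (a i) (b i))) r"
  \<comment> \<open>J indexes the bars alive at r. Outside J the summand is the zero space at this
    stage, so extending by zero from J reaches every element.\<close>
  let ?f = "\<lambda>c. \<lambda>i\<in>{..<n}. if i \<in> J then c i else \<zero>"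
  have J: "i < n \<and> a i \<le> r \<and> ereal r < b i \<longleftrightarrow> i \<in> J" "i \<in> J \<Longrightarrow> i < n" for i by (auto simp: J_def)
  have carr: "carrier (stage (interval_module R (a i) (b i)) r) = (if i \<in> J then carrier R else {\<zero>})"
    if "i < n" for i
    using that by (simp add: interval_stage_simps J_def)
  have D: "carrier ?D = (\<Pi>\<^sub>E i\<in>{..<n}. if i \<in> J then carrier R else {\<zero>})"
    unfolding direct_sum_stage_simps using carr by (intro PiE_cong) simp
  have "finite J" by (simp add: J_def)
  moreover have "module R ?D"
    using persistence_module_interval
    by (intro module_direct_sum_stage is_cring) (simp add: persistence_module_def)
  moreover have "?f \<in> linear_maps R (func_space J) ?D"
  proof -
    have "?f c \<in> carrier ?D" if "c \<in> J \<rightarrow>\<^sub>E carrier R" for c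
      unfolding D using that by (intro restrict_PiE_iff[THEN iffD2]) auto
    moreover have "?f (\<lambda>i\<in>J. c i \<oplus> d i) = ?f c \<oplus>\<^bsub>?D\<^esub> ?f d" for c d
      unfolding direct_sum_stage_simps interval_stage_simps by (intro restrict_ext) simp
    moreover have "?f (\<lambda>i\<in>J. x \<otimes> c i) = x \<odot>\<^bsub>?D\<^esub> ?f c" if "x \<in> carrier R" for x c
      unfolding direct_sum_stage_simps interval_stage_simps using that by (intro restrict_ext) simp
    ultimately show ?thesis by (simp add: linear_maps_def func_space_def)
  qed
  moreover have "bij_betw ?f (carrier (func_space J)) (carrier ?D)"
  proof (rule bij_betw_byWitness[where f' = "\<lambda>c. restrict c J"])
    show "\<forall>c\<in>carrier (func_space J). restrict (?f c) J = c"
    proof (intro ballI ext)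
      fix c i assume "c \<in> carrier (func_space J)"
      then show "restrict (?f c) J i = c i"
        using J(2)[of i] by (cases "i \<in> J") (simp_all add: func_space_def PiE_iff extensional_def)
    qed
    show "\<forall>c\<in>carrier ?D. ?f (restrict c J) = c"
    proof (intro ballI ext)
      fix c i assume c: "c \<in> carrier ?D"
      show "?f (restrict c J) i = c i"
      proof (cases "i < n")
        case True
        then show ?thesis using PiE_mem[OF c[unfolded D], of i] by (auto split: if_splits)
      next
        case False
        then show ?thesis using PiE_arb[OF c[unfolded D], of i] by simp
      qed
    qed
    show "?f ` carrier (func_space J) \<subseteq> carrier ?D"
      unfolding D by (intro image_subsetI restrict_PiE_iff[THEN iffD2]) (auto simp: func_space_def)
    show "(\<lambda>c. restrict c J) ` carrier ?D \<subseteq> carrier (func_space J)"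
    proof (intro image_subsetI)
      fix c assume c: "c \<in> carrier ?D"
      have "c i \<in> carrier R" if "i \<in> J" for i
        using PiE_mem[OF c[unfolded D], of i] that J(2)[OF that] by simp
      then show "restrict c J \<in> carrier (func_space J)" by (simp add: func_space_def)
    qed
  qed
  ultimately show ?thesis
    unfolding J_def[symmetric] by (intro has_dim_bij_betw[OF has_dim_func_space])
qed

lemma has_dim_barcode_stage:
  assumes K: "field K" and M: "has_barcode K M n a b"
  shows "has_dim K (stage M r) (card {i. i < n \<and> a i \<le> r \<and> ereal r < b i})"
proof -
  let ?D = "pm_direct_sum n (\<lambda>i. interval_module K (a i) (b i))"
  have iso: "pm_iso K M ?D" using M by (simp add: has_barcode_def)
  then have "\<exists>f. \<forall>r. f r \<in> linear_maps K (stage M r) (stage ?D r) \<and>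
      bij_betw (f r) (carrier (stage M r)) (carrier (stage ?D r))"
    unfolding pm_iso_def by (elim conjE exE) (rule exI)
  then obtain f where f: "f r \<in> linear_maps K (stage M r) (stage ?D r)"
    "bij_betw (f r) (carrier (stage M r)) (carrier (stage ?D r))"
    by auto
  have "persistence_module K M" "persistence_module K ?D" using iso by (simp_all add: pm_iso_def)
  then have "module K (stage M r)" "module K (stage ?D r)" by (simp_all add: persistence_module_def)
  from has_dim_bij_betw_iff[OF this f] show ?thesis using field.has_dim_bars_stage[OF K] by blast
qed

lemma magnitude_eq_barcode_sum:
  assumes K: "field K" and t: "t > 0" and M: "has_barcode K M n a b"
  shows "magnitude K M t = (\<Sum>i<n. exp_neg (ereal (a i)) t - exp_neg (b i) t)"
  unfolding magnitude_def
proof (rule the_equality)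
  show "\<exists>n' a' b'. has_barcode K M n' a' b' \<and>
      (\<Sum>i<n. exp_neg (ereal (a i)) t - exp_neg (b i) t) =
      (\<Sum>i<n'. exp_neg (ereal (a' i)) t - exp_neg (b' i) t)"
    using M by blast
next
  fix s assume "\<exists>n a b. has_barcode K M n a b \<and> s = (\<Sum>i<n. exp_neg (ereal (a i)) t - exp_neg (b i) t)"
  then obtain n' a' b' where M': "has_barcode K M n' a' b'"
    and s: "s = (\<Sum>i<n'. exp_neg (ereal (a' i)) t - exp_neg (b' i) t)" by blast
  \<comment> \<open>Both counts are the dimension of stage r of the same module M.\<close>
  have "card {i. i < n' \<and> a' i \<le> r \<and> ereal r < b' i} = card {i. i < n \<and> a i \<le> r \<and> ereal r < b i}" for r
    by (rule has_dim_unique[OF has_dim_barcode_stage[OF K M'] has_dim_barcode_stage[OF K M]])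
  moreover have "(\<Sum>i<n. 1 * of_bool (a i \<le> r \<and> ereal r < b i)) =
      real (card {i. i < n \<and> a i \<le> r \<and> ereal r < b i})" for n :: nat and a b r
  proof -
    have "{i. i < n \<and> a i \<le> r \<and> ereal r < b i} = {..<n} \<inter> {i. a i \<le> r \<and> ereal r < b i}" by auto
    then show ?thesis by (simp add: sum_of_bool_eq)
  qed
  \<comment> \<open>Both sums are read as bar sums with unit weights, so that their step functions
    are the two bar counts.\<close>
  ultimately have "(\<Sum>i<n'. 1 * (exp_neg (ereal (a' i)) t - exp_neg (b' i) t)) =
      (\<Sum>i<n. 1 * (exp_neg (ereal (a i)) t - exp_neg (b i) t))"
    using M M' by (intro bar_sum_cong[OF t]) (simp_all add: has_barcode_def del: mult_1)
  then show "s = (\<Sum>i<n. exp_neg (ereal (a i)) t - exp_neg (b i) t)" by (simp add: s)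
qed

section \<open>Barcode and magnitude of the chains of a filtered complex\<close>

lemma has_barcode_filtered_chains:
  fixes w :: "'a set \<Rightarrow> real"
  assumes K: "field K" and g: "bij_betw g {..<n} (simplices S k)"
    and F: "\<And>r. F r = {\<sigma> \<in> S. w \<sigma> \<le> r}"
  shows "has_barcode K (filtered_chains K F k) n (\<lambda>i. w (g i)) (\<lambda>_. \<infinity>)"
proof -
  interpret field K by (rule K)
  let ?D = "pm_direct_sum n (\<lambda>i. interval_module K (w (g i)) \<infinity>)"
  \<comment> \<open>Each simplex spans a copy of K that is born at its weight and never dies.
    Reading off the coefficients of a chain along the enumeration g is the isomorphism.\<close>
  let ?f = "\<lambda>c. \<lambda>i\<in>{..<n}. c (g i)"
  have simp_F: "\<sigma> \<in> simplices (F r) k \<longleftrightarrow> \<sigma> \<in> simplices S k \<and> w \<sigma> \<le> r" for r \<sigma>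
    by (auto simp: F simplices_def)
  have gS: "g i \<in> simplices S k" if "i < n" for i using g that by (auto simp: bij_betw_def)
  define h where "h = inv_into {..<n} g"
  have h: "h \<sigma> < n" "g (h \<sigma>) = \<sigma>" if "\<sigma> \<in> simplices S k" for \<sigma>
    using g that inv_into_into[of \<sigma> g "{..<n}"] by (auto simp: h_def bij_betw_def f_inv_into_f)
  have hg: "h (g i) = i" if "i < n" for i
    using g that by (simp add: h_def bij_betw_def)
  have D: "carrier (stage ?D r) = (\<Pi>\<^sub>E i\<in>{..<n}. if w (g i) \<le> r then carrier K else {\<zero>\<^bsub>K\<^esub>})" for r
    unfolding direct_sum_stage_simps interval_stage_simps by simp
  have pM: "persistence_module K (filtered_chains K F k)"
    using module_chain_space
    by (auto simp: persistence_module_def filtered_chains_def linear_maps_def chain_space_simps simp_F)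
  have pD: "persistence_module K ?D"
    by (intro persistence_module_direct_sum persistence_module_interval is_cring)
  have lin: "?f \<in> linear_maps K (stage (filtered_chains K F k) r) (stage ?D r)" for r
  proof -
    have "?f c \<in> carrier (stage ?D r)" if "c \<in> carrier (chain_space K (F r) k)" for c
      unfolding D using that gS
      by (intro restrict_PiE_iff[THEN iffD2]) (auto simp: chain_space_simps simp_F)
    then show ?thesis
      by (auto simp: linear_maps_def filtered_chains_def chain_space_simps(2-)
          direct_sum_stage_simps(2-) interval_stage_simps(2-) intro!: restrict_ext)
  qed
  have bij: "bij_betw ?f (carrier (stage (filtered_chains K F k) r)) (carrier (stage ?D r))" for r
  proof (rule bij_betw_byWitness[where f' = "\<lambda>c \<sigma>. if \<sigma> \<in> simplices S k then c (h \<sigma>) else \<zero>\<^bsub>K\<^esub>"])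
    let ?C = "carrier (stage (filtered_chains K F k) r)"
    let ?g = "\<lambda>c \<sigma>. if \<sigma> \<in> simplices S k then c (h \<sigma>) else \<zero>\<^bsub>K\<^esub>"
    have C: "?C = {c. (\<forall>\<sigma>. \<sigma> \<in> simplices S k \<and> w \<sigma> \<le> r \<longrightarrow> c \<sigma> \<in> carrier K) \<and>
        (\<forall>\<sigma>. \<not> (\<sigma> \<in> simplices S k \<and> w \<sigma> \<le> r) \<longrightarrow> c \<sigma> = \<zero>\<^bsub>K\<^esub>)}"
      by (simp add: filtered_chains_def chain_space_simps simp_F Ball_def)
    show "\<forall>c\<in>?C. ?g (?f c) = c"
    proof (intro ballI ext)
      fix c \<sigma> assume "c \<in> ?C"
      then show "?g (?f c) \<sigma> = c \<sigma>" unfolding C by (cases "\<sigma> \<in> simplices S k") (simp_all add: h)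
    qed
    show "\<forall>c\<in>carrier (stage ?D r). ?f (?g c) = c"
    proof (intro ballI ext)
      fix c i assume c: "c \<in> carrier (stage ?D r)"
      show "?f (?g c) i = c i"
        using PiE_arb[OF c[unfolded D], of i] by (cases "i < n") (simp_all add: gS hg)
    qed
    show "?f ` ?C \<subseteq> carrier (stage ?D r)"
      unfolding C D using gS by (intro image_subsetI restrict_PiE_iff[THEN iffD2]) auto
    show "?g ` carrier (stage ?D r) \<subseteq> ?C"
    proof (intro image_subsetI)
      fix c assume c: "c \<in> carrier (stage ?D r)"
      have "(w \<sigma> \<le> r \<longrightarrow> c (h \<sigma>) \<in> carrier K) \<and> (\<not> w \<sigma> \<le> r \<longrightarrow> c (h \<sigma>) = \<zero>\<^bsub>K\<^esub>)"
        if "\<sigma> \<in> simplices S k" for \<sigma>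
        using PiE_mem[OF c[unfolded D], of "h \<sigma>"] h[OF that] by (auto split: if_splits)
      then show "?g c \<in> ?C" unfolding C by auto
    qed
  qed
  \<comment> \<open>For a simplex present at stage r both structure maps keep its coefficient. One
    not yet present has coefficient zero in c, which matches the zero map of its bar.\<close>
  have nat: "?f (pmap (filtered_chains K F k) r s c) = pmap ?D r s (?f c)"
    if "r \<le> s" "c \<in> carrier (stage (filtered_chains K F k) r)" for r s c
    using that
    by (auto simp: filtered_chains_def pm_direct_sum_def interval_module_def fun_eq_iff
        chain_space_simps simp_F)
  have "pm_iso K (filtered_chains K F k) ?D"
    unfolding pm_iso_def
    by (intro conjI exI[of _ "\<lambda>_. ?f"] allI impI ballI pM pD lin bij nat; assumption)
  then show ?thesis by (simp add: has_barcode_def)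
qed

lemma magnitude_filtered_chains:
  fixes w :: "'a set \<Rightarrow> real"
  assumes K: "field K" and t: "t > 0" and fin: "finite (simplices S k)"
    and F: "\<And>r. F r = {\<sigma> \<in> S. w \<sigma> \<le> r}"
  shows "magnitude K (filtered_chains K F k) t = (\<Sum>\<sigma>\<in>simplices S k. exp (- w \<sigma> * t))"
proof -
  obtain g where g: "bij_betw g {..<card (simplices S k)} (simplices S k)"
    using ex_bij_betw_nat_finite[OF fin] by (auto simp: atLeast0LessThan)
  have "magnitude K (filtered_chains K F k) t = (\<Sum>i<card (simplices S k). exp (- w (g i) * t))"
    using magnitude_eq_barcode_sum[OF K t has_barcode_filtered_chains[OF K g F]]
    by (simp add: exp_neg_def)
  also have "\<dots> = (\<Sum>\<sigma>\<in>simplices S k. exp (- w \<sigma> * t))"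
    by (rule sum.reindex_bij_betw[OF g])
  finally show ?thesis .
qed

text \<open>\<open>graded_magnitude\<close> sums over the degrees with a nonzero stage; these are
  exactly the degrees in which S has simplices. Grouping the simplices by degree then turns the sum
  over S into the graded one.\<close>

lemma graded_magnitude_filtered_chains:
  fixes w :: "'a set \<Rightarrow> real"
  assumes K: "field K" and t: "t > 0"
    and S: "finite S" "\<And>\<sigma>. \<sigma> \<in> S \<Longrightarrow> finite \<sigma> \<and> \<sigma> \<noteq> {}"
    and F: "\<And>r. F r = {\<sigma> \<in> S. w \<sigma> \<le> r}"
  shows "graded_magnitude K (filtered_chains K F) t = (\<Sum>\<sigma>\<in>S. (- 1) ^ (card \<sigma> - 1) * exp (- w \<sigma> * t))"
proof -
  interpret field K by (rule K)
  have fin: "finite (simplices S k)" for k using S by (simp add: simplices_def)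
  have "(\<exists>r. carrier (chain_space K (F r) k) \<noteq> {\<zero>\<^bsub>chain_space K (F r) k\<^esub>}) \<longleftrightarrow> simplices S k \<noteq> {}" for k
  proof
    assume "simplices S k \<noteq> {}"
    then obtain \<sigma> where \<sigma>: "\<sigma> \<in> simplices S k" by blast
    \<comment> \<open>The indicator chain of \<sigma> exists from stage \<open>w \<sigma>\<close> on
      and is nonzero because one differs from zero in a field.\<close>
    define c where "c = (\<lambda>\<tau>. if \<tau> = \<sigma> then \<one>\<^bsub>K\<^esub> else \<zero>\<^bsub>K\<^esub>)"
    have "\<sigma> \<in> simplices (F (w \<sigma>)) k" using \<sigma> by (simp add: F simplices_def)
    then have "c \<in> carrier (chain_space K (F (w \<sigma>)) k)" by (auto simp: c_def chain_space_simps)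
    moreover have "c \<sigma> \<noteq> \<zero>\<^bsub>K\<^esub>" by (simp add: c_def)
    then have "c \<noteq> \<zero>\<^bsub>chain_space K (F (w \<sigma>)) k\<^esub>" by (auto simp: chain_space_simps)
    ultimately show "\<exists>r. carrier (chain_space K (F r) k) \<noteq> {\<zero>\<^bsub>chain_space K (F r) k\<^esub>}" by blast
  next
    assume "\<exists>r. carrier (chain_space K (F r) k) \<noteq> {\<zero>\<^bsub>chain_space K (F r) k\<^esub>}"
    then obtain r where "carrier (chain_space K (F r) k) \<noteq> {\<zero>\<^bsub>chain_space K (F r) k\<^esub>}" by blast
    then have "simplices (F r) k \<noteq> {}" by (auto simp: chain_space_simps fun_eq_iff)
    then show "simplices S k \<noteq> {}" by (auto simp: F simplices_def)
  qed
  then have "graded_magnitude K (filtered_chains K F) t =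
      (\<Sum>k | simplices S k \<noteq> {}. (- 1) ^ k * (\<Sum>\<sigma>\<in>simplices S k. exp (- w \<sigma> * t)))"
    unfolding graded_magnitude_def
    using magnitude_filtered_chains[OF K t fin F] by (simp add: filtered_chains_def)
  also have "\<dots> = (\<Sum>k | simplices S k \<noteq> {}. \<Sum>\<sigma>\<in>simplices S k. (- 1) ^ (card \<sigma> - 1) * exp (- w \<sigma> * t))"
    by (intro sum.cong refl) (auto simp: sum_distrib_left simplices_def)
  also have "\<dots> = (\<Sum>\<sigma>\<in>S. (- 1) ^ (card \<sigma> - 1) * exp (- w \<sigma> * t))"
    by (rule sum_simplices[OF S, symmetric])
  finally show ?thesis .
qed

lemma rips_magnitude_eq:
  fixes X :: "'a::metric_space set"
  assumes "field K" "t > 0" "finite X"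
  shows "rips_magnitude K X t =
    (\<Sum>A | A \<subseteq> X \<and> A \<noteq> {}. (- 1) ^ (card A - 1) * exp (- diameter A * t))"
  unfolding rips_magnitude_def
  using assms(3)
  by (intro graded_magnitude_filtered_chains[OF assms(1,2)])
    (auto simp: rips_def intro: finite_subset)

section \<open>Euler--Poincare formula\<close>

lemma (in abelian_monoid) finsum_swap:
  assumes "finite A" "finite B" "\<And>i j. i \<in> A \<Longrightarrow> j \<in> B \<Longrightarrow> f i j \<in> carrier G"
  shows "(\<Oplus>i\<in>A. \<Oplus>j\<in>B. f i j) = (\<Oplus>j\<in>B. \<Oplus>i\<in>A. f i j)"
  using assms(1,3)
proof (induction A)
  case (insert a A)
  have "(\<Oplus>i\<in>insert a A. \<Oplus>j\<in>B. f i j) = (\<Oplus>j\<in>B. f a j) \<oplus> (\<Oplus>j\<in>B. \<Oplus>i\<in>A. f i j)"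
    using insert by (subst finsum_insert) (auto intro!: finsum_closed)
  also have "\<dots> = (\<Oplus>j\<in>B. f a j \<oplus> (\<Oplus>i\<in>A. f i j))"
    using insert by (intro finsum_addf[symmetric]) (auto intro!: finsum_closed)
  also have "\<dots> = (\<Oplus>j\<in>B. \<Oplus>i\<in>insert a A. f i j)"
    using insert by (intro finsum_cong') (auto intro!: finsum_closed finsum_insert[symmetric])
  finally show ?case .
qed simp

text \<open>The order lives on a fixed vertex set X that contains the simplices, so one order
  orients all stages of a filtration at once.\<close>

locale oriented_complex = field K for K :: "('k, 'c) ring_scheme" (structure) +
  fixes X :: "'a set" and ord :: "'a rel" and S :: "'a set set"
  assumes finite_complex: "finite S"
    and linear: "linear_order_on X ord"
    and simplex: "\<And>\<sigma>. \<sigma> \<in> S \<Longrightarrow> finite \<sigma> \<and> \<sigma> \<noteq> {} \<and> \<sigma> \<subseteq> X"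
    and face: "\<And>\<sigma> \<tau>. \<sigma> \<in> S \<Longrightarrow> \<tau> \<subseteq> \<sigma> \<Longrightarrow> \<tau> \<noteq> {} \<Longrightarrow> \<tau> \<in> S"
begin

lemma finite_simplices: "finite (simplices S k)"
  using finite_complex by (simp add: simplices_def)

lemma incidence_closed [simp]: "incidence K ord \<sigma> \<tau> \<in> carrier K"
  by (simp add: incidence_def)

section \<open>The boundary operator and the vanishing of its square\<close>

abbreviation "cofaces k \<tau> \<equiv> {\<sigma> \<in> simplices S k. \<tau> \<subseteq> \<sigma> \<and> card \<sigma> = Suc (card \<tau>)}"

lemma boundary_apply:
  "boundary K ord S k c \<tau> =
    (if \<tau> \<in> S then \<Oplus>\<sigma>\<in>cofaces k \<tau>. incidence K ord \<sigma> \<tau> \<otimes> c \<sigma> else \<zero>)"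
  by (simp add: boundary_def)

text \<open>At k = 0 the truncated \<open>k - 1\<close> makes the target degree 0 again, which is
  consistent because the boundary is zero there. Simplices are nonempty, so
  \<open>card \<tau> = k\<close> places \<tau> in degree k - 1 whenever it has a coface.\<close>

lemma boundary_closed:
  assumes "c \<in> carrier (chain_space K S k)"
  shows "boundary K ord S k c \<in> carrier (chain_space K S (k - 1))"
proof -
  have "boundary K ord S k c \<tau> \<in> carrier K" for \<tau>
    using chain_closed[OF assms] by (auto simp: boundary_apply intro!: finsum_closed)
  moreover have "boundary K ord S k c \<tau> = \<zero>" if "\<tau> \<notin> simplices S (k - 1)" for \<tau>
  proof (cases "\<tau> \<in> S")
    case True
    then have "card \<tau> > 0" using simplex by (simp add: card_gt_0_iff)
    then have empty: "cofaces k \<tau> = {}" using that True by (auto simp: simplices_def)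
    show ?thesis unfolding boundary_apply empty by simp
  qed (simp add: boundary_apply)
  ultimately show ?thesis by (simp add: chain_space_simps)
qed

lemma boundary_linear:
  "boundary K ord S k \<in> linear_maps K (chain_space K S k) (chain_space K S (k - 1))"
proof -
  have "boundary K ord S k (\<lambda>\<sigma>. c \<sigma> \<oplus> d \<sigma>) \<tau> = boundary K ord S k c \<tau> \<oplus> boundary K ord S k d \<tau>"
    if "c \<in> carrier (chain_space K S k)" "d \<in> carrier (chain_space K S k)" for c d \<tau>
    using chain_closed[OF that(1)] chain_closed[OF that(2)]
    by (simp add: boundary_apply r_distr finsum_addf Pi_iff)
  moreover have "boundary K ord S k (\<lambda>\<sigma>. x \<otimes> c \<sigma>) \<tau> = x \<otimes> boundary K ord S k c \<tau>"
    if "x \<in> carrier K" "c \<in> carrier (chain_space K S k)" for x c \<tau>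
    using chain_closed[OF that(2)] that(1) finite_simplices[of k]
    by (simp add: boundary_apply m_lcomm finsum_rdistr Pi_iff)
  ultimately show ?thesis
    using boundary_closed by (simp add: linear_maps_def chain_space_simps(2-) fun_eq_iff)
qed

text \<open>Let \<open>p w\<close> count the vertices of \<rho> before w. Since u precedes v,
  omitting v from \<sigma> also counts u and gives the sign exponent \<open>Suc (p v)\<close>,
  whereas omitting u does not count v and gives \<open>p u\<close>. The two routes from \<sigma> to
  \<rho> thus differ by exactly one sign.\<close>

lemma incidence_cancel:
  assumes \<sigma>: "\<sigma> \<in> S" "\<sigma> = insert u (insert v \<rho>)" and uv: "u \<notin> \<rho>" "v \<notin> \<rho>" "u \<noteq> v"
    and ord: "(u, v) \<in> ord" and x: "x \<in> carrier K"
  shows "incidence K ord (insert u \<rho>) \<rho> \<otimes> (incidence K ord \<sigma> (insert u \<rho>) \<otimes> x) \<oplus>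
    incidence K ord (insert v \<rho>) \<rho> \<otimes> (incidence K ord \<sigma> (insert v \<rho>) \<otimes> x) = \<zero>"
proof -
  define p where "p = (\<lambda>w. card {y \<in> \<rho>. (y, w) \<in> ord})"
  have "finite \<rho>" using simplex[OF \<sigma>(1)] \<sigma>(2) by simp
  have vu: "(v, u) \<notin> ord"
    using linear ord uv(3) by (auto simp: linear_order_on_def partial_order_on_def antisym_def)
  have single: "incidence K ord (insert w \<rho>) \<rho> = (\<ominus> \<one>) [^] p w" if "w \<notin> \<rho>" for w
  proof -
    have "{y \<in> insert w \<rho>. \<exists>x\<in>insert w \<rho> - \<rho>. y \<noteq> x \<and> (y, x) \<in> ord} = {y \<in> \<rho>. (y, w) \<in> ord}"
      using that by (auto simp: insert_Diff_if)
    then show ?thesis by (simp add: incidence_def p_def)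
  qed
  have diff: "\<sigma> - insert u \<rho> = {v}" "\<sigma> - insert v \<rho> = {u}" using uv by (auto simp: \<sigma>(2))
  have "{y \<in> \<sigma>. \<exists>x\<in>\<sigma> - insert u \<rho>. y \<noteq> x \<and> (y, x) \<in> ord} = insert u {y \<in> \<rho>. (y, v) \<in> ord}"
    unfolding diff using uv ord by (auto simp: \<sigma>(2))
  then have "incidence K ord \<sigma> (insert u \<rho>) = (\<ominus> \<one>) [^] Suc (p v)"
    using \<open>finite \<rho>\<close> uv by (simp add: incidence_def p_def)
  moreover have "{y \<in> \<sigma>. \<exists>x\<in>\<sigma> - insert v \<rho>. y \<noteq> x \<and> (y, x) \<in> ord} = {y \<in> \<rho>. (y, u) \<in> ord}"
    unfolding diff using uv vu by (auto simp: \<sigma>(2))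
  then have "incidence K ord \<sigma> (insert v \<rho>) = (\<ominus> \<one>) [^] p u"
    by (simp add: incidence_def p_def)
  moreover define a b where "a = (\<ominus> \<one>) [^] p u" and "b = (\<ominus> \<one>) [^] p v"
  have "a \<in> carrier K" "b \<in> carrier K" by (simp_all add: a_def b_def)
  then have "a \<otimes> (b \<otimes> \<ominus> \<one> \<otimes> x) \<oplus> b \<otimes> (a \<otimes> x) = \<zero>"
    using x by (simp add: l_minus r_minus m_lcomm[of b a] l_neg)
  ultimately show ?thesis using single uv by (simp add: a_def b_def)
qed

text \<open>The coefficient at \<rho> is a double sum over chains of faces \<rho>, \<tau>, \<sigma>.
  With \<sigma> fixed outside, exactly two \<tau> lie between when \<sigma> has two more vertices
  than \<rho>, and they cancel; otherwise no \<tau> contributes.\<close>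

lemma boundary_boundary:
  assumes c: "c \<in> carrier (chain_space K S (Suc k))"
  shows "boundary K ord S k (boundary K ord S (Suc k) c) = (\<lambda>\<tau>. \<zero>)"
proof
  fix \<rho>
  show "boundary K ord S k (boundary K ord S (Suc k) c) \<rho> = \<zero>"
  proof (cases "\<rho> \<in> S")
    case True
    define T where "T = cofaces k \<rho>"
    define U where "U = simplices S (Suc k)"
    \<comment> \<open>Extending the incidence terms by zero makes the range of \<sigma> independent
      of \<tau>, as exchanging the two sums requires.\<close>
    define g where "g = (\<lambda>\<tau> \<sigma>. if \<tau> \<subseteq> \<sigma> \<and> card \<sigma> = Suc (card \<tau>) then incidence K ord \<sigma> \<tau> \<otimes> c \<sigma> else \<zero>)"
    have fin: "finite T" "finite U" using finite_simplices by (auto simp: T_def U_def)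
    have g: "g \<tau> \<sigma> \<in> carrier K" for \<tau> \<sigma> using chain_closed[OF c] by (simp add: g_def)
    have inner: "boundary K ord S (Suc k) c \<tau> = (\<Oplus>\<sigma>\<in>U. g \<tau> \<sigma>)" if "\<tau> \<in> T" for \<tau>
    proof -
      have "\<tau> \<in> S" using that by (simp add: T_def simplices_def)
      then have "boundary K ord S (Suc k) c \<tau> = (\<Oplus>\<sigma>\<in>cofaces (Suc k) \<tau>. incidence K ord \<sigma> \<tau> \<otimes> c \<sigma>)"
        by (simp add: boundary_apply)
      also have "\<dots> = (\<Oplus>\<sigma>\<in>U. g \<tau> \<sigma>)"
        using fin g by (intro add.finprod_mono_neutral_cong_left) (auto simp: U_def g_def)
      finally show ?thesis .
    qed
    have zero: "(\<Oplus>\<tau>\<in>T. incidence K ord \<tau> \<rho> \<otimes> g \<tau> \<sigma>) = \<zero>" if \<sigma>: "\<sigma> \<in> U" for \<sigma>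
    proof (cases "\<rho> \<subseteq> \<sigma> \<and> card \<sigma> = Suc (Suc (card \<rho>))")
      case False
      have "g \<tau> \<sigma> = \<zero>" if "\<tau> \<in> T" for \<tau> using False that by (auto simp: T_def g_def)
      then show ?thesis by (simp add: finsum_zero' cong: finsum_cong')
    next
      case True
      have \<sigma>S: "\<sigma> \<in> S" "card \<sigma> = k + 2" using \<sigma> by (simp_all add: U_def simplices_def)
      have fin\<rho>: "finite \<rho>" using simplex \<open>\<rho> \<in> S\<close> by simp
      have "card (\<sigma> - \<rho>) = 2" using True fin\<rho> by (simp add: card_Diff_subset)
      then obtain u v where "\<sigma> - \<rho> = {u, v}" "u \<noteq> v" by (auto simp: card_2_iff)
      \<comment> \<open>Totality of the order allows the two extra vertices to be named so that u
        precedes v.\<close>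
      moreover have "(u, v) \<in> ord \<or> (v, u) \<in> ord"
        using calculation linear simplex[OF \<sigma>S(1)]
        by (auto simp: linear_order_on_def total_on_def)
      ultimately obtain u v where uv: "\<sigma> - \<rho> = {u, v}" "u \<noteq> v" "(u, v) \<in> ord"
        by (metis insert_commute)
      have \<sigma>_eq: "\<sigma> = insert u (insert v \<rho>)" and notin: "u \<notin> \<rho>" "v \<notin> \<rho>" using uv True by auto
      have ne: "insert u \<rho> \<noteq> insert v \<rho>" using uv(2) notin by auto
      have faces: "insert u \<rho> \<in> S" "insert v \<rho> \<in> S" using face[OF \<sigma>S(1)] \<sigma>_eq by auto
      have T_iff: "\<tau> \<in> T \<and> \<tau> \<subseteq> \<sigma> \<longleftrightarrow> \<tau> = insert u \<rho> \<or> \<tau> = insert v \<rho>" for \<tau>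
      proof
        assume \<tau>: "\<tau> \<in> T \<and> \<tau> \<subseteq> \<sigma>"
        then have \<tau>': "\<rho> \<subseteq> \<tau>" "card \<tau> = Suc (card \<rho>)" by (auto simp: T_def)
        then have "card (\<tau> - \<rho>) = 1" using fin\<rho> by (simp add: card_Diff_subset)
        then obtain w where "\<tau> - \<rho> = {w}" by (auto simp: card_1_singleton_iff)
        moreover have "\<tau> - \<rho> \<subseteq> {u, v}" using \<tau> uv(1) by blast
        ultimately show "\<tau> = insert u \<rho> \<or> \<tau> = insert v \<rho>" using \<tau>' by auto
      next
        assume "\<tau> = insert u \<rho> \<or> \<tau> = insert v \<rho>"
        then show "\<tau> \<in> T \<and> \<tau> \<subseteq> \<sigma>"
          using faces notin fin\<rho> True \<sigma>S(2) by (auto simp: T_def simplices_def \<sigma>_eq)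
      qed
      have g_uv: "g (insert w \<rho>) \<sigma> = incidence K ord \<sigma> (insert w \<rho>) \<otimes> c \<sigma>" if "w \<in> {u, v}" for w
      proof -
        have "insert w \<rho> \<subseteq> \<sigma>" "w \<notin> \<rho>" using that \<sigma>_eq notin by auto
        then show ?thesis using fin\<rho> True by (simp add: g_def)
      qed
      have "(\<Oplus>\<tau>\<in>T. incidence K ord \<tau> \<rho> \<otimes> g \<tau> \<sigma>) =
          (\<Oplus>\<tau>\<in>{insert u \<rho>, insert v \<rho>}. incidence K ord \<tau> \<rho> \<otimes> g \<tau> \<sigma>)"
      proof (rule add.finprod_mono_neutral_cong_right)
        show "finite T" by (rule fin)
        show "{insert u \<rho>, insert v \<rho>} \<subseteq> T" using T_iff by blast
        show "incidence K ord \<tau> \<rho> \<otimes> g \<tau> \<sigma> = \<zero>" if "\<tau> \<in> T - {insert u \<rho>, insert v \<rho>}" for \<tau>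
        proof -
          have "\<not> \<tau> \<subseteq> \<sigma>" using that T_iff by blast
          then show ?thesis by (simp add: g_def)
        qed
      qed (use g in auto)
      also have "\<dots> = incidence K ord (insert u \<rho>) \<rho> \<otimes> g (insert u \<rho>) \<sigma> \<oplus>
          incidence K ord (insert v \<rho>) \<rho> \<otimes> g (insert v \<rho>) \<sigma>"
        using ne g by (simp add: finsum_insert)
      also have "\<dots> = \<zero>"
        using incidence_cancel[OF \<sigma>S(1) \<sigma>_eq notin uv(2,3)] chain_closed[OF c] by (simp add: g_uv)
      finally show ?thesis .
    qed
    have "boundary K ord S k (boundary K ord S (Suc k) c) \<rho> =
        (\<Oplus>\<tau>\<in>T. incidence K ord \<tau> \<rho> \<otimes> boundary K ord S (Suc k) c \<tau>)"
      using True by (simp add: boundary_apply[of k] T_def)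
    also have "\<dots> = (\<Oplus>\<tau>\<in>T. \<Oplus>\<sigma>\<in>U. incidence K ord \<tau> \<rho> \<otimes> g \<tau> \<sigma>)"
      using inner g fin by (intro finsum_cong') (auto simp: finsum_rdistr intro!: finsum_closed)
    also have "\<dots> = (\<Oplus>\<sigma>\<in>U. \<Oplus>\<tau>\<in>T. incidence K ord \<tau> \<rho> \<otimes> g \<tau> \<sigma>)"
      using fin g by (intro finsum_swap) auto
    also have "\<dots> = (\<Oplus>\<sigma>\<in>U. \<zero>)" using zero by (intro finsum_cong') auto
    also have "\<dots> = \<zero>" by simp
    finally show ?thesis .
  qed (simp add: boundary_apply)
qed

lemma boundary_0: "boundary K ord S 0 c = (\<lambda>\<tau>. \<zero>)"
proof
  fix \<tau>
  show "boundary K ord S 0 c \<tau> = \<zero>"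
  proof (cases "\<tau> \<in> S")
    case True
    then have empty: "cofaces 0 \<tau> = {}" using simplex by (auto simp: simplices_def)
    show ?thesis unfolding boundary_apply empty by simp
  qed (simp add: boundary_apply)
qed

section \<open>Cycles, boundaries and the alternating sum of Betti numbers\<close>

lemma linear_map_boundary:
  "linear_map K (chain_space K S k) (chain_space K S (k - 1)) (boundary K ord S k)"
  by (intro linear_map_if_linear_maps field_axioms module_chain_space boundary_linear)

lemma submodule_cycles: "submodule K (cycles K ord S k) (chain_space K S k)"
proof -
  interpret linear_map K "chain_space K S k" "chain_space K S (k - 1)" "boundary K ord S k"
    by (rule linear_map_boundary)
  have "ker = cycles K ord S k" by (simp only: ker_def cycles_def chain_space_simps(2))
  then show ?thesis using ker_is_submodule by simp
qed

lemma submodule_boundaries: "submodule K (boundaries K ord S k) (chain_space K S k)"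
proof -
  interpret linear_map K "chain_space K S (Suc k)" "chain_space K S (Suc k - 1)" "boundary K ord S (Suc k)"
    by (rule linear_map_boundary)
  have "im = boundaries K ord S k" by (simp add: im_def boundaries_def)
  then show ?thesis using im_is_submodule by simp
qed

lemma boundaries_subset_cycles: "boundaries K ord S k \<subseteq> cycles K ord S k"
  using boundary_boundary boundary_closed[of _ "Suc k"] by (auto simp: boundaries_def cycles_def)

text \<open>Rank-nullity for the boundary gives cycles plus image, and the cycles split further into
  boundaries and homology. The image is not written as \<open>boundaries K ord S (k - 1)\<close>,
  because at k = 0 truncation would turn that into the image of the boundary from degree 1.\<close>

lemma has_dim_chain_decomposition:
  obtains b b' h where
    "has_dim K ((chain_space K S (k - 1))\<lparr>carrier := boundary K ord S k ` carrier (chain_space K S k)\<rparr>) b"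
    "has_dim K ((chain_space K S k)\<lparr>carrier := boundaries K ord S k\<rparr>) b'"
    "has_dim K (homology_space K ord S k) h"
    "card (simplices S k) = b + b' + h"
proof -
  obtain z b where
    z: "has_dim K ((chain_space K S k)\<lparr>carrier := {c \<in> carrier (chain_space K S k).
      boundary K ord S k c = \<zero>\<^bsub>chain_space K S (k - 1)\<^esub>}\<rparr>) z" and
    b: "has_dim K ((chain_space K S (k - 1))\<lparr>carrier := boundary K ord S k ` carrier (chain_space K S k)\<rparr>) b"
    and zb: "card (simplices S k) = z + b"
    by (rule rank_nullity_has_dim[OF has_dim_chain_space[OF finite_simplices]
        module_chain_space boundary_linear])
  have z: "has_dim K ((chain_space K S k)\<lparr>carrier := cycles K ord S k\<rparr>) z"
    using z by (simp only: cycles_def chain_space_simps(2))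
  obtain b' h where "has_dim K ((chain_space K S k)\<lparr>carrier := boundaries K ord S k\<rparr>) b'"
    "has_dim K (homology_space K ord S k) h" "z = b' + h"
    unfolding homology_space_def
    by (rule dim_subquotient[OF field_axioms module_chain_space submodule_cycles submodule_boundaries
        boundaries_subset_cycles z])
  then show ?thesis using that b zb by simp
qed

text \<open>With \<open>b k\<close> the rank of the boundary out of degree k, the number of
  k-simplices is \<open>b k + b (Suc k) + h k\<close>. In the alternating sum the ranks cancel in
  consecutive pairs, leaving \<open>b 0\<close> and \<open>b N\<close>. Both vanish: the boundary is
  zero in degree 0, and there are no N-simplices.\<close>

lemma euler_characteristic_eq_homology:
  assumes N: "\<And>\<sigma>. \<sigma> \<in> S \<Longrightarrow> card \<sigma> \<le> N"
    and h: "\<And>k. has_dim K (homology_space K ord S k) (h k)"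
  shows "euler_characteristic S = (\<Sum>k<N. (- 1) ^ k * int (h k))"
proof -
  let ?I = "\<lambda>k. (chain_space K S (k - 1))\<lparr>carrier := boundary K ord S k ` carrier (chain_space K S k)\<rparr>"
  have "\<exists>b. has_dim K (?I k) b" for k
    by (rule has_dim_chain_decomposition[of k]) (rule exI)
  then obtain b where b: "\<And>k. has_dim K (?I k) (b k)" by metis
  have card: "card (simplices S k) = b k + b (Suc k) + h k" for k
  proof (rule has_dim_chain_decomposition[of k])
    fix m m' l
    assume "has_dim K (?I k) m"
      and "has_dim K ((chain_space K S k)\<lparr>carrier := boundaries K ord S k\<rparr>) m'"
      and "has_dim K (homology_space K ord S k) l"
      and eq: "card (simplices S k) = m + m' + l"
    \<comment> \<open>The boundaries in degree k are the image of the boundary from degree k + 1, so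
      by uniqueness of dimension \<open>m'\<close> is the rank \<open>b (Suc k)\<close>.\<close>
    moreover have "?I (Suc k) = (chain_space K S k)\<lparr>carrier := boundaries K ord S k\<rparr>"
      by (simp add: boundaries_def)
    ultimately have "m = b k" "m' = b (Suc k)" "l = h k"
      using has_dim_unique[OF _ b[of k]] has_dim_unique[OF _ b[of "Suc k"]] has_dim_unique[OF _ h[of k]]
      by simp_all
    then show ?thesis using eq by simp
  qed
  have "b 0 = 0"
  proof (rule has_dim_zero_space[OF b])
    have "(\<lambda>_. \<zero>) \<in> carrier (chain_space K S 0)" by (simp add: chain_space_simps)
    then show "carrier (?I 0) = {\<zero>\<^bsub>?I 0\<^esub>}" by (auto simp: boundary_0 chain_space_simps(2))
  qed
  have "simplices S N = {}" using N by (force simp: simplices_def)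
  then have "b N = 0" using card[of N] by simp
  have tel: "(\<Sum>k<n. (- 1) ^ k * (int (b k) + int (b (Suc k)))) = int (b 0) - (- 1) ^ n * int (b n)" for n
    by (induction n) (simp_all add: algebra_simps)
  have "euler_characteristic S = (\<Sum>k<N. (- 1) ^ k * int (card (simplices S k)))"
    by (rule euler_characteristic_eq_sum_lessThan[OF N])
  also have "\<dots> = (\<Sum>k<N. (- 1) ^ k * int (h k)) + (\<Sum>k<N. (- 1) ^ k * (int (b k) + int (b (Suc k))))"
    by (simp add: card algebra_simps flip: sum.distrib)
  also have "\<dots> = (\<Sum>k<N. (- 1) ^ k * int (h k))" using tel[of N] \<open>b 0 = 0\<close> \<open>b N = 0\<close> by simp
  finally show ?thesis .
qed

end

section \<open>Rips magnitude\<close>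

lemma rips_magnitude_eq_homology_barcode:
  fixes X :: "'a::metric_space set"
  assumes K: "field K" and X: "finite X" "X \<noteq> {}" and t: "t > 0" and ord: "linear_order_on X ord"
    and bars: "graded_has_barcode K (filtered_homology K ord (rips X)) m a b"
  shows "rips_magnitude K X t = (\<Sum>k = 0..card X - 1. \<Sum>j<m k.
    (- 1) ^ k * (exp_neg (ereal (a k j)) t - exp_neg (b k j) t))"
proof -
  have hb: "has_barcode K (filtered_homology K ord (rips X) k) (m k) (a k) (b k)" for k
    using bars by (simp add: graded_has_barcode_def)
  \<comment> \<open>Pairs of a degree and a bar flatten the double sum into one signed bar sum, with
    weight \<open>(- 1) ^ k\<close>, as \<open>bar_sum_cong\<close> expects.\<close>
  define D where "D = (SIGMA k:{..<card X}. {..<m k})"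
  \<comment> \<open>At each r the number of degree-k bars alive is the dimension of the k-th
    homology of that stage, so the signed count is an Euler characteristic. Simplices have at most
    \<open>card X\<close> vertices, so degrees below \<open>card X\<close> suffice.\<close>
  have step: "(\<Sum>(k, j)\<in>D. (- 1) ^ k * of_bool (a k j \<le> r \<and> ereal r < b k j)) =
      real_of_int (euler_characteristic (rips X r))" for r
  proof -
    interpret oriented_complex K X ord "rips X r"
    proof (intro oriented_complex.intro oriented_complex_axioms.intro K ord finite_rips X)
      show "finite \<sigma> \<and> \<sigma> \<noteq> {} \<and> \<sigma> \<subseteq> X" if "\<sigma> \<in> rips X r" for \<sigma>
        using that X by (auto simp: rips_def intro: finite_subset)
    qed (rule rips_downward_closed[OF X(1)])
    have "has_dim K (homology_space K ord (rips X r) k)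
        (card {j. j < m k \<and> a k j \<le> r \<and> ereal r < b k j})" for k
      using has_dim_barcode_stage[OF K hb, of k r] by (simp add: filtered_homology_def)
    moreover have "card \<sigma> \<le> card X" if "\<sigma> \<in> rips X r" for \<sigma>
      using that X by (intro card_mono) (auto simp: rips_def)
    ultimately have "euler_characteristic (rips X r) =
        (\<Sum>k<card X. (- 1) ^ k * int (card {j. j < m k \<and> a k j \<le> r \<and> ereal r < b k j}))"
      by (intro euler_characteristic_eq_homology)
    also have "real_of_int \<dots> = (\<Sum>k<card X. \<Sum>j<m k. (- 1) ^ k * of_bool (a k j \<le> r \<and> ereal r < b k j))"
    proof -
      have "real (card {j. j < m k \<and> a k j \<le> r \<and> ereal r < b k j}) =
          (\<Sum>j<m k. of_bool (a k j \<le> r \<and> ereal r < b k j))" for k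
      proof -
        have "{j. j < m k \<and> a k j \<le> r \<and> ereal r < b k j} =
            {..<m k} \<inter> {j. a k j \<le> r \<and> ereal r < b k j}" by auto
        then show ?thesis by (simp add: sum_of_bool_eq)
      qed
      then show ?thesis by (simp add: sum_distrib_left mult.commute)
    qed
    also have "\<dots> = (\<Sum>(k, j)\<in>D. (- 1) ^ k * of_bool (a k j \<le> r \<and> ereal r < b k j))"
      unfolding D_def by (rule sum.Sigma) auto
    finally show ?thesis by (rule sym)
  qed
  have "(\<Sum>p\<in>D. (- 1) ^ fst p * (exp_neg (ereal (a (fst p) (snd p))) t - exp_neg (b (fst p) (snd p)) t)) =
      (\<Sum>A | A \<subseteq> X \<and> A \<noteq> {}. (- 1) ^ (card A - 1) * (exp_neg (ereal (diameter A)) t - exp_neg \<infinity> t))"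
  proof (rule bar_sum_cong[OF t])
    show "finite D" by (simp add: D_def)
    show "finite {A. A \<subseteq> X \<and> A \<noteq> {}}" using X by simp
    show "ereal (a (fst p) (snd p)) < b (fst p) (snd p)" if "p \<in> D" for p
      using hb[of "fst p"] that by (auto simp: has_barcode_def D_def)
    show "(\<Sum>p\<in>D. (- 1 :: real) ^ fst p * of_bool (a (fst p) (snd p) \<le> r \<and> ereal r < b (fst p) (snd p))) =
        (\<Sum>A | A \<subseteq> X \<and> A \<noteq> {}. (- 1) ^ (card A - 1) * of_bool (diameter A \<le> r \<and> ereal r < \<infinity>))" for r
      using step[of r] by (simp add: euler_characteristic_rips[OF X(1)] case_prod_unfold)
  qed simp
  also have "\<dots> = rips_magnitude K X t"
    using rips_magnitude_eq[OF K t X(1)] by (simp add: exp_neg_def)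
  finally have "rips_magnitude K X t =
      (\<Sum>(k, j)\<in>D. (- 1) ^ k * (exp_neg (ereal (a k j)) t - exp_neg (b k j) t))"
    by (simp add: case_prod_unfold)
  also have "\<dots> = (\<Sum>k<card X. \<Sum>j<m k. (- 1) ^ k * (exp_neg (ereal (a k j)) t - exp_neg (b k j) t))"
    by (simp add: D_def sum.Sigma)
  \<comment> \<open>X is nonempty, so \<open>card X - 1\<close> is a genuine predecessor and the two
    ranges agree.\<close>
  also have "{..<card X} = {0..card X - 1}"
  proof -
    have "card X > 0" using X by (simp add: card_gt_0_iff)
    then show ?thesis by auto
  qed
  finally show ?thesis .
qed

theorem proposition7p2:
  fixes K :: "('k, 'c) ring_scheme" and X :: "'a::metric_space set"
  assumes "field K" and "finite X" and "X \<noteq> {}"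
  shows
    "(\<forall>t>0. rips_magnitude K X t =
        (\<Sum>A | A \<subseteq> X \<and> A \<noteq> {}. (- 1) ^ (card A - 1) * exp (- diameter A * t))) \<and>
     (\<forall>ord m a b. linear_order_on X ord \<longrightarrow>
        graded_has_barcode K (filtered_homology K ord (rips X)) m a b \<longrightarrow>
        (\<forall>t>0. rips_magnitude K X t =
          (\<Sum>k = 0..card X - 1. \<Sum>j<m k.
             (- 1) ^ k * (exp_neg (ereal (a k j)) t - exp_neg (b k j) t)))) \<and>
     (\<forall>n. \<forall>d :: nat \<Rightarrow> ereal.
        d 0 = 0 \<longrightarrow> strict_mono_on {0..n} d \<longrightarrow>
        d ` {0..n} = {ereal (dist x y) | x y. x \<in> X \<and> y \<in> X} \<longrightarrow> d (n + 1) = \<infinity> \<longrightarrow>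
        (\<forall>t>0. rips_magnitude K X t =
          (\<Sum>j = 0..n. of_int (euler_characteristic (rips X (real_of_ereal (d j)))) *
             (exp_neg (d j) t - exp_neg (d (j + 1)) t)))) \<and>
     (((\<lambda>t. rips_magnitude K X t) \<longlongrightarrow> 1) (at_right 0)) \<and>
     (((\<lambda>t. rips_magnitude K X t) \<longlongrightarrow> real (card X)) at_top)"
proof (intro conjI allI impI)
  fix t :: real assume "t > 0"
  then show "rips_magnitude K X t =
      (\<Sum>A | A \<subseteq> X \<and> A \<noteq> {}. (- 1) ^ (card A - 1) * exp (- diameter A * t))"
    by (rule rips_magnitude_eq[OF assms(1) _ assms(2)])
next
  fix ord m a b and t :: real
  assume "linear_order_on X ord" "graded_has_barcode K (filtered_homology K ord (rips X)) m a b" "t > 0"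
  then show "rips_magnitude K X t = (\<Sum>k = 0..card X - 1. \<Sum>j<m k.
      (- 1) ^ k * (exp_neg (ereal (a k j)) t - exp_neg (b k j) t))"
    by (intro rips_magnitude_eq_homology_barcode assms)
next
  fix n and d :: "nat \<Rightarrow> ereal" and t :: real
  assume d: "strict_mono_on {0..n} d"
    "d ` {0..n} = {ereal (dist x y) | x y. x \<in> X \<and> y \<in> X}" "d (n + 1) = \<infinity>" and t: "t > 0"
  show "rips_magnitude K X t =
      (\<Sum>j = 0..n. of_int (euler_characteristic (rips X (real_of_ereal (d j)))) *
        (exp_neg (d j) t - exp_neg (d (j + 1)) t))"
    using sum_euler_characteristic_rips[OF assms(2) d] rips_magnitude_eq[OF assms(1) t assms(2)]
    by simp
next
  \<comment> \<open>The formula (1) is available only for t > 0, which holds eventually when 0 is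
    approached from the right.\<close>
  have "eventually (\<lambda>t. (\<Sum>A | A \<subseteq> X \<and> A \<noteq> {}. (- 1) ^ (card A - 1) * exp (- diameter A * t)) =
      rips_magnitude K X t) (at_right 0)"
    using eventually_at_right_less by eventually_elim (rule rips_magnitude_eq[OF assms(1) _ assms(2), symmetric])
  then show "((\<lambda>t. rips_magnitude K X t) \<longlongrightarrow> 1) (at_right 0)"
    by (rule Lim_transform_eventually[OF tendsto_alternating_diameter_sum_0[OF assms(2,3)]])
next
  have "eventually (\<lambda>t. (\<Sum>A | A \<subseteq> X \<and> A \<noteq> {}. (- 1) ^ (card A - 1) * exp (- diameter A * t)) =
      rips_magnitude K X t) at_top"
    using eventually_gt_at_top[of 0] by eventually_elim (rule rips_magnitude_eq[OF assms(1) _ assms(2), symmetric])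
  then show "((\<lambda>t. rips_magnitude K X t) \<longlongrightarrow> real (card X)) at_top"
    by (rule Lim_transform_eventually[OF tendsto_alternating_diameter_sum_at_top[OF assms(2)]])
qed

end
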